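(* There exist absolute constants $K>0$ and $C>0$ such that the following holds. Let $n\ge1$ and $p\in(0,1)$ be such that $pn$ is an integer and $p(1-p)n\ge 3\log n$. Let $f$ be a real harmonic multilinear polynomial in $x_1,\dots,x_n$ of degree $d$ satisfying $d\le K\sqrt{p(1-p)n}$ and such that the variance of $f$ with respect to $\nu_{pn}$ equals $1$. Then for every $1$-Lipschitz function $\varphi\colon\mathbb R\to\mathbb R$, $$\bigl|\mathbb E_{\nu_{pn}}[\varphi(f)]-\mathbb E_{\mu_p}[\varphi(f)]\bigr|\le C\sqrt{\frac{d}{\sqrt{p(1-p)n}}}.$$
   Context: A polynomial in $x_1,\dots,x_n$ is multilinear if all its monomials are squarefree, and harmonic if $\sum_{i=1}^n \frac{\partial f}{\partial x_i}=0$. For an integer $0\le k\le n$, $\nu_k$ is the uniform probability measure on the slice $\{x\in\{0,1\}^n:\sum_i x_i=k\}$. For $p\in(0,1)$, $\mu_p$ is the product measure on $\{0,1\}^n$ with $\mu_p(x)=p^{\sum_i x_i}(1-p)^{\sum_i(1-x_i)}$. A function $\varphi$ is $1$-Lipschitz if $|\varphi(x)-\varphi(y)|\le|x-y|$ for all $x,y$. *)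

theory Defs
  imports "HOL-Probability.Probability" "HOL-Library.Poly_Mapping"
begin

text \<open>
  A polynomial is a finitely supported family of coefficients indexed by monomials, and a monomial
  is a finitely supported family of exponents. The variables are indexed by \<open>{1..n}\<close>.
\<close>

type_synonym mpoly = "(nat \<Rightarrow>\<^sub>0 nat) \<Rightarrow>\<^sub>0 real"

definition poly_in :: "nat \<Rightarrow> mpoly \<Rightarrow> bool" where
  "poly_in n f \<longleftrightarrow> (\<forall>m \<in> Poly_Mapping.keys f. Poly_Mapping.keys m \<subseteq> {1..n})"

definition eval_poly :: "mpoly \<Rightarrow> (nat \<Rightarrow> real) \<Rightarrow> real" where
  "eval_poly f x = (\<Sum>m \<in> Poly_Mapping.keys f. Poly_Mapping.lookup f m *
     (\<Prod>i \<in> Poly_Mapping.keys m. x i ^ Poly_Mapping.lookup m i))"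

text \<open>The total degree; the zero polynomial gets degree 0.\<close>

definition total_degree :: "mpoly \<Rightarrow> nat" where
  "total_degree f = Max (insert 0
     ((\<lambda>m. \<Sum>i \<in> Poly_Mapping.keys m. Poly_Mapping.lookup m i) ` Poly_Mapping.keys f))"

text \<open>
  The formal partial derivative in \<open>x\<^sub>i\<close>. Truncated subtraction of exponents is harmless:
  a monomial not containing \<open>x\<^sub>i\<close> gets coefficient 0.
\<close>

definition partial_deriv :: "nat \<Rightarrow> mpoly \<Rightarrow> mpoly" where
  "partial_deriv i f = (\<Sum>m \<in> Poly_Mapping.keys f.
     Poly_Mapping.single (m - Poly_Mapping.single i 1)
       (Poly_Mapping.lookup f m * real (Poly_Mapping.lookup m i)))"

definition multilinear :: "mpoly \<Rightarrow> bool" where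
  "multilinear f \<longleftrightarrow> (\<forall>m \<in> Poly_Mapping.keys f. \<forall>i. Poly_Mapping.lookup m i \<le> 1)"

definition harmonic :: "nat \<Rightarrow> mpoly \<Rightarrow> bool" where
  "harmonic n f \<longleftrightarrow> (\<Sum>i=1..n. partial_deriv i f) = 0"

text \<open>Points of \<open>{0,1}\<^sup>n\<close> are functions that are \<^const>\<open>undefined\<close> outside \<open>{1..n}\<close>.\<close>

definition cube :: "nat \<Rightarrow> (nat \<Rightarrow> real) set" where
  "cube n = {1..n} \<rightarrow>\<^sub>E {0, 1}"

definition slice :: "nat \<Rightarrow> nat \<Rightarrow> (nat \<Rightarrow> real) set" where
  "slice n k = {x \<in> cube n. (\<Sum>i=1..n. x i) = real k}"

definition nu :: "nat \<Rightarrow> nat \<Rightarrow> (nat \<Rightarrow> real) pmf" where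
  "nu n k = pmf_of_set (slice n k)"

definition mu :: "nat \<Rightarrow> real \<Rightarrow> (nat \<Rightarrow> real) pmf" where
  "mu n p = Pi_pmf {1..n} undefined (\<lambda>_. map_pmf of_bool (bernoulli_pmf p))"

text \<open>\<^const>\<open>pmf_of_set\<close> is the uniform measure only on finite nonempty sets.\<close>

lemma finite_slice: "finite (slice n k)"
  unfolding slice_def cube_def by (auto intro!: finite_subset[OF _ finite_PiE[of "{1..n}" "\<lambda>_. {0,1}"]])

lemma slice_nonempty:
  assumes "k \<le> n"
  shows "slice n k \<noteq> {}"
proof -
  let ?x = "\<lambda>i. if i \<in> {1..n} then of_bool (i \<le> k) else undefined :: real"
  have "(\<Sum>i=1..n. ?x i) = (\<Sum>i\<in>{1..n}. if i \<in> {1..k} then 1 else 0)"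
    by (intro sum.cong) auto
  also have "\<dots> = (\<Sum>i\<in>{1..n} \<inter> {1..k}. 1)"
    by (subst sum.inter_restrict) auto
  also have "{1..n} \<inter> {1..k} = {1..k}"
    using assms by auto
  finally have "?x \<in> slice n k"
    unfolding slice_def cube_def by (auto simp: PiE_def extensional_def)
  then show ?thesis by blast
qed

lemma pmf_mu:
  assumes p: "0 < p" "p < 1" and x: "x \<in> cube n"
  shows "pmf (mu n p) x = p powr (\<Sum>i=1..n. x i) * (1 - p) powr (\<Sum>i=1..n. 1 - x i)"
proof -
  have inj: "inj (of_bool :: bool \<Rightarrow> real)"
    by (auto simp: inj_on_def)
  have one: "pmf (map_pmf of_bool (bernoulli_pmf p)) (x i) = p powr x i * (1 - p) powr (1 - x i)"
    if "i \<in> {1..n}" for i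
  proof -
    have "x i = of_bool False \<or> x i = of_bool True"
      using x that by (auto simp: cube_def PiE_def Pi_def)
    then show ?thesis
      using p by (auto simp only: pmf_map_inj'[OF inj]) auto
  qed
  have "pmf (mu n p) x = (\<Prod>i=1..n. pmf (map_pmf of_bool (bernoulli_pmf p)) (x i))"
    unfolding mu_def using x by (subst pmf_Pi') (auto simp: cube_def PiE_def extensional_def)
  also have "\<dots> = (\<Prod>i=1..n. p powr x i * (1 - p) powr (1 - x i))"
    using one by (intro prod.cong) auto
  also have "\<dots> = p powr (\<Sum>i=1..n. x i) * (1 - p) powr (\<Sum>i=1..n. 1 - x i)"
    using p by (simp add: prod.distrib powr_sum)
  finally show ?thesis .
qed

end

theory Submission
  imports Defs
begin

text \<open>
  Identify \<open>{0,1}\<^sup>n\<close> with the subsets of \<open>V = {1..n}\<close>. A multilinear polynomial with coefficients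
  \<open>c\<close> becomes the set function \<open>F A = (\<Sum>S\<subseteq>A. c S)\<close>, and harmonicity becomes
  \<open>(\<Sum>i\<in>V - T. c (T \<union> {i})) = 0\<close> for all \<open>T \<subseteq> V\<close>. Write \<open>F = (\<Sum>j\<le>d. F\<^sub>j)\<close> for the decomposition into
  homogeneous parts, \<open>k = p n\<close> and \<open>s\<^sup>2 = p (1 - p) n\<close>.

  The homogeneous parts are eigenfunctions of the random walk between levels: if \<open>card B = m + 1\<close>,
  the sum of \<open>F\<^sub>j\<close> over the sets \<open>B - {i}\<close> is \<open>(m + 1 - j) F\<^sub>j B\<close>, and if \<open>card A = m\<close>, harmonicity makes
  the sum of \<open>F\<^sub>j\<close> over the sets \<open>A \<union> {i}\<close> equal to \<open>(n - m - j) F\<^sub>j A\<close>. The two walks are adjoint to each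
  other, so that the inner products \<open>h\<^sub>m = (\<Sum>card A = m. F\<^sub>i A * F\<^sub>j A)\<close> satisfy two first-order
  recurrences in \<open>m\<close>, one for each of the two orders of \<open>i\<close> and \<open>j\<close>. For \<open>i \<noteq> j\<close>
  and \<open>i + j \<le> n\<close> these are incompatible unless \<open>h\<^sub>m = 0\<close> (lemma \<open>level_inner_orthogonal\<close>), and for \<open>i = j\<close> they give
  \<open>h\<^sub>m = (n - 2j choose m - j) * (\<Sum>S. c\<^sub>j(S)\<^sup>2)\<close> (lemma \<open>level_inner_norm\<close>).

  Now couple level \<open>k\<close> with level \<open>l\<close> by a uniform pair of nested sets of sizes \<open>k\<close> and \<open>l\<close>. All
  quantities in \<open>E (F(A) - F(B))\<^sup>2\<close> are explicit. With \<open>a\<^sub>j\<close> the second moment of \<open>F\<^sub>j\<close> on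
  level \<open>k\<close>, the mixed term \<open>E (F(A) F(B))\<close> is at least \<open>(\<Sum>j. a\<^sub>j (1 - j |l - k| / s\<^sup>2))\<close> for every \<open>l\<close>
  (lemma \<open>nested_corr_lower_bound\<close>), including the
  levels far from \<open>k\<close>. Average over \<open>l\<close> with binomial weights. The mean of \<open>|l - k|\<close> is at most the standard deviation \<open>s\<close>,
  and the second moment of \<open>F\<^sub>j\<close> under the product measure is at most \<open>(1 + j\<^sup>2 / s\<^sup>2) a\<^sub>j\<close> (lemma
  \<open>part_norm_sq_Bernstein_le\<close>). Since \<open>j \<le> d \<le> s\<close>, the averaged squared difference is at most
  \<open>(\<Sum>j. (1 + (1 + j/s) - 2 (1 - j/s)) a\<^sub>j) = (\<Sum>j. (3 j/s) a\<^sub>j) \<le> 3 d / s\<close>, because the \<open>a\<^sub>j\<close> with \<open>j \<ge> 1\<close> sum to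
  the variance \<open>1\<close>. A Lipschitz function of \<open>F\<close> therefore changes its mean by at most the square
  root of this, and the constants \<open>K = 1\<close> and \<open>C = 2\<close> suffice.
\<close>

section \<open>Polynomials as set functions, and sums over nested sets\<close>

definition level :: "'a set \<Rightarrow> nat \<Rightarrow> 'a set set" where
  "level V m = {A. A \<subseteq> V \<and> card A = m}"

text \<open>
  The value at the indicator vector of \<open>A\<close> of the multilinear polynomial with coefficients \<open>c\<close>.
\<close>

definition mlin :: "('a set \<Rightarrow> real) \<Rightarrow> 'a set \<Rightarrow> real" where
  "mlin c A = (\<Sum>S\<in>Pow A. c S)"

text \<open>
  The left-hand side is the coefficient of the monomial \<open>\<Prod>i\<in>T. x\<^sub>i\<close> in the sum of all partial
  derivatives.
\<close>

definition harmonic_coeffs :: "'a set \<Rightarrow> ('a set \<Rightarrow> real) \<Rightarrow> bool" where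
  "harmonic_coeffs V c \<longleftrightarrow> (\<forall>T\<subseteq>V. (\<Sum>i\<in>V - T. c (insert i T)) = 0)"

definition homogeneous :: "nat \<Rightarrow> ('a set \<Rightarrow> real) \<Rightarrow> bool" where
  "homogeneous j c \<longleftrightarrow> (\<forall>S. c S \<noteq> 0 \<longrightarrow> card S = j)"

definition homogeneous_part :: "nat \<Rightarrow> ('a set \<Rightarrow> real) \<Rightarrow> 'a set \<Rightarrow> real" where
  "homogeneous_part j c S = (if card S = j then c S else 0)"

lemma finite_level [simp]: "finite V \<Longrightarrow> finite (level V m)"
  by (auto simp: level_def intro: finite_subset[of _ "Pow V"])

lemma card_level: "finite V \<Longrightarrow> card (level V m) = card V choose m"
  unfolding level_def by (rule n_subsets)

lemma sum_nested_swap: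
  fixes h :: "'a set \<Rightarrow> 'a set \<Rightarrow> real"
  assumes "finite V"
  shows "(\<Sum>B\<in>level V b. \<Sum>A\<in>level B a. h A B) =
         (\<Sum>A\<in>level V a. \<Sum>B | B \<in> level V b \<and> A \<subseteq> B. h A B)"
proof -
  have "(\<Sum>B\<in>level V b. \<Sum>A\<in>level B a. h A B) =
        (\<Sum>B\<in>level V b. \<Sum>A | A \<in> level V a \<and> A \<subseteq> B. h A B)"
    by (intro sum.cong) (auto simp: level_def)
  also have "\<dots> = (\<Sum>A\<in>level V a. \<Sum>B | B \<in> level V b \<and> A \<subseteq> B. h A B)"
    using assms by (intro sum.swap_restrict) auto
  finally show ?thesis .
qed

text \<open>
  Complementation in \<open>V\<close> turns the sets between \<open>A\<close> and \<open>V\<close> into the subsets of \<open>V - A\<close>. Counting with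
  \<open>card V - b\<close> keeps the formula correct when \<open>b < card A\<close>, where the binomial coefficient vanishes.
\<close>

lemma card_level_above:
  assumes "finite V" "A \<subseteq> V" "b \<le> card V"
  shows "card {B \<in> level V b. A \<subseteq> B} = (card V - card A) choose (card V - b)"
proof -
  have "bij_betw (\<lambda>B. V - B) {B \<in> level V b. A \<subseteq> B} (level (V - A) (card V - b))"
  proof (rule bij_betwI[where g = "\<lambda>C. V - C"])
    show "(\<lambda>B. V - B) \<in> {B \<in> level V b. A \<subseteq> B} \<rightarrow> level (V - A) (card V - b)"
      using assms by (auto simp: level_def card_Diff_subset finite_subset)
    show "(\<lambda>C. V - C) \<in> level (V - A) (card V - b) \<rightarrow> {B \<in> level V b. A \<subseteq> B}"
    proof
      fix C assume C: "C \<in> level (V - A) (card V - b)"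
      then have "C \<subseteq> V" "finite C" using assms by (auto simp: level_def intro: finite_subset)
      then show "V - C \<in> {B \<in> level V b. A \<subseteq> B}"
        using C assms by (auto simp: level_def card_Diff_subset)
    qed
  qed (use assms in \<open>auto simp: level_def\<close>)
  then have "card {B \<in> level V b. A \<subseteq> B} = card (level (V - A) (card V - b))"
    by (rule bij_betw_same_card)
  then show ?thesis
    using assms by (simp add: card_level card_Diff_subset finite_subset)
qed

lemma sum_nested:
  fixes h :: "'a set \<Rightarrow> real"
  assumes "finite V" "b \<le> card V"
  shows "(\<Sum>B\<in>level V b. \<Sum>A\<in>level B a. h A) =
         real ((card V - a) choose (card V - b)) * (\<Sum>A\<in>level V a. h A)"
proof -
  have "(\<Sum>B\<in>level V b. \<Sum>A\<in>level B a. h A) =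
        (\<Sum>A\<in>level V a. real (card {B \<in> level V b. A \<subseteq> B}) * h A)"
    using assms by (simp add: sum_nested_swap)
  also have "\<dots> = (\<Sum>A\<in>level V a. real ((card V - a) choose (card V - b)) * h A)"
    using assms by (intro sum.cong refl) (subst card_level_above, auto simp: level_def)
  finally show ?thesis by (simp add: sum_distrib_left)
qed

lemma mlin_homogeneous:
  assumes "finite A" "homogeneous j c"
  shows "mlin c A = (\<Sum>S\<in>level A j. c S)"
  unfolding mlin_def
  using assms by (intro sum.mono_neutral_right) (auto simp: level_def homogeneous_def)

section \<open>The walk between levels and its eigenfunctions\<close>

text \<open>
  The eigenfunction property for passing to subsets: each monomial of \<open>c\<close> inside \<open>B\<close> is counted
  once for every set of size \<open>a\<close> between it and \<open>B\<close>, and this number depends only on the degree \<open>j\<close>.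
\<close>

lemma sum_below_homogeneous:
  assumes "finite B" "homogeneous j c" "a \<le> card B"
  shows "(\<Sum>A\<in>level B a. mlin c A) = real ((card B - j) choose (card B - a)) * mlin c B"
proof -
  have "(\<Sum>A\<in>level B a. mlin c A) = (\<Sum>A\<in>level B a. \<Sum>S\<in>level A j. c S)"
    using assms by (intro sum.cong refl mlin_homogeneous) (auto simp: level_def intro: finite_subset)
  then show ?thesis
    using assms by (simp add: sum_nested mlin_homogeneous)
qed

text \<open>
  The eigenfunction property for adding one element. The increment of the polynomial when \<open>i\<close> is
  added to \<open>A\<close> is \<open>(\<Sum>T\<subseteq>A. c (T \<union> {i}))\<close>. Summed over \<open>i \<in> V - A\<close>, harmonicity replaces it by minus the
  same sum over \<open>i \<in> A - T\<close>, in which every monomial \<open>S \<subseteq> A\<close> occurs once for each of its \<open>j\<close> elements.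
\<close>

lemma sum_above_harmonic:
  assumes V: "finite V" and hom: "homogeneous j c" and harm: "harmonic_coeffs V c"
    and A: "A \<subseteq> V" "card A = m"
  shows "(\<Sum>B | B \<in> level V (Suc m) \<and> A \<subseteq> B. mlin c B) = (real (card V) - real m - real j) * mlin c A"
proof -
  have fA: "finite A" using A V finite_subset by auto
  have mV: "m \<le> card V" using A V card_mono by auto
  have "(\<Sum>B | B \<in> level V (Suc m) \<and> A \<subseteq> B. mlin c B) = (\<Sum>i\<in>V - A. mlin c (insert i A))"
  proof -
    have inj: "inj_on (\<lambda>i. insert i A) (V - A)" by (auto simp: inj_on_def)
    have "{B. B \<in> level V (Suc m) \<and> A \<subseteq> B} = (\<lambda>i. insert i A) ` (V - A)"
    proof (intro equalityI subsetI)
      fix B assume B: "B \<in> {B. B \<in> level V (Suc m) \<and> A \<subseteq> B}"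
      then have "card (B - A) = 1" using A fA by (auto simp: level_def card_Diff_subset)
      then obtain i where "B - A = {i}" by (auto simp: card_1_singleton_iff)
      then have "B = insert i A" "i \<in> V - A" using B by (auto simp: level_def)
      then show "B \<in> (\<lambda>i. insert i A) ` (V - A)" by blast
    qed (use A fA in \<open>auto simp: level_def\<close>)
    then show ?thesis using inj by (simp add: sum.reindex)
  qed
  also have "\<dots> = (\<Sum>i\<in>V - A. mlin c A + (\<Sum>T\<in>Pow A. c (insert i T)))"
  proof (intro sum.cong refl)
    fix i assume i: "i \<in> V - A"
    have "mlin c (insert i A) = (\<Sum>S\<in>Pow A \<union> insert i ` Pow A. c S)"
      by (simp add: mlin_def Pow_insert)
    also have "\<dots> = mlin c A + (\<Sum>S\<in>insert i ` Pow A. c S)"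
      unfolding mlin_def using i fA by (intro sum.union_disjoint) auto
    also have "(\<Sum>S\<in>insert i ` Pow A. c S) = (\<Sum>T\<in>Pow A. c (insert i T))"
      using i by (subst sum.reindex) (auto simp: inj_on_def)
    finally show "mlin c (insert i A) = mlin c A + (\<Sum>T\<in>Pow A. c (insert i T))" .
  qed
  also have "\<dots> = (real (card V) - real m) * mlin c A + (\<Sum>i\<in>V - A. \<Sum>T\<in>Pow A. c (insert i T))"
    using A V fA mV by (simp add: sum.distrib card_Diff_subset of_nat_diff)
  also have "(\<Sum>i\<in>V - A. \<Sum>T\<in>Pow A. c (insert i T)) = (\<Sum>T\<in>Pow A. \<Sum>i\<in>V - A. c (insert i T))"
    by (rule sum.swap)
  also have "\<dots> = (\<Sum>T\<in>Pow A. - (\<Sum>i\<in>A - T. c (insert i T)))"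
  proof (intro sum.cong refl)
    fix T assume T: "T \<in> Pow A"
    have "(\<Sum>i\<in>V - T. c (insert i T)) = 0"
      using harm T A unfolding harmonic_coeffs_def by auto
    moreover have "V - T = (V - A) \<union> (A - T)" using T A by auto
    ultimately have "(\<Sum>i\<in>V - A. c (insert i T)) + (\<Sum>i\<in>A - T. c (insert i T)) = 0"
      using T A V fA by (subst sum.union_disjoint[symmetric]) auto
    then show "(\<Sum>i\<in>V - A. c (insert i T)) = - (\<Sum>i\<in>A - T. c (insert i T))" by simp
  qed
  also have "\<dots> = - (\<Sum>T\<in>Pow A. \<Sum>i\<in>A - T. c (insert i T))"
    by (simp add: sum_negf)
  also have "(\<Sum>T\<in>Pow A. \<Sum>i\<in>A - T. c (insert i T)) = (\<Sum>S\<in>Pow A. \<Sum>i\<in>S. c S)"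
  proof -
    have "(\<Sum>T\<in>Pow A. \<Sum>i\<in>A - T. c (insert i T)) =
          (\<Sum>(T, i)\<in>Sigma (Pow A) (\<lambda>T. A - T). c (insert i T))"
      using fA by (simp add: sum.Sigma)
    also have "\<dots> = (\<Sum>(S, i)\<in>Sigma (Pow A) (\<lambda>S. S). c S)"
      by (rule sum.reindex_bij_witness[where i = "\<lambda>(S, i). (S - {i}, i)" and j = "\<lambda>(T, i). (insert i T, i)"])
        (auto simp: insert_absorb)
    also have "\<dots> = (\<Sum>S\<in>Pow A. \<Sum>i\<in>S. c S)"
      using fA by (subst sum.Sigma) (auto intro: finite_subset)
    finally show ?thesis .
  qed
  also have "\<dots> = real j * mlin c A"
    unfolding mlin_def sum_distrib_left using hom
    by (intro sum.cong refl) (auto simp: homogeneous_def)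
  finally show ?thesis by (simp add: algebra_simps)
qed

definition level_inner :: "'a set \<Rightarrow> nat \<Rightarrow> ('a set \<Rightarrow> real) \<Rightarrow> ('a set \<Rightarrow> real) \<Rightarrow> real" where
  "level_inner V m c c' = (\<Sum>A\<in>level V m. mlin c A * mlin c' A)"

lemma level_inner_commute: "level_inner V m c c' = level_inner V m c' c"
  by (simp add: level_inner_def mult.commute)

text \<open>
  Sum \<open>mlin c B * mlin c' A\<close> over all pairs \<open>A \<subseteq> B\<close> of sizes \<open>m\<close> and \<open>m + 1\<close> in two ways: summing over \<open>A\<close>
  first uses the step down for \<open>c'\<close>, summing over \<open>B\<close> first uses the step up for \<open>c\<close>.
\<close>

lemma level_inner_step:
  assumes V: "finite V" and m: "m < card V"
    and c: "homogeneous i c" "harmonic_coeffs V c" and c': "homogeneous j c'"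
  shows "(real (Suc m) - real j) * level_inner V (Suc m) c c' =
         (real (card V) - real m - real i) * level_inner V m c c'"
proof -
  have "(real (Suc m) - real j) * level_inner V (Suc m) c c' =
        (\<Sum>B\<in>level V (Suc m). mlin c B * (\<Sum>A\<in>level B m. mlin c' A))"
    unfolding level_inner_def
  proof (subst sum_distrib_left, intro sum.cong refl)
    fix B assume B: "B \<in> level V (Suc m)"
    then have fB: "finite B" using V by (auto simp: level_def intro: finite_subset)
    have "(\<Sum>A\<in>level B m. mlin c' A) = real (Suc m - j) * mlin c' B"
      using B fB c' by (subst sum_below_homogeneous) (auto simp: level_def)
    moreover have "mlin c' B = 0" if "Suc m < j"
      using that B fB c' by (subst mlin_homogeneous) (auto simp: level_def intro!: sum.neutral dest: card_mono)
    ultimately have "(\<Sum>A\<in>level B m. mlin c' A) = (real (Suc m) - real j) * mlin c' B"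
      by (cases "Suc m < j") (auto simp: of_nat_diff)
    then show "(real (Suc m) - real j) * (mlin c B * mlin c' B) = mlin c B * (\<Sum>A\<in>level B m. mlin c' A)"
      by simp
  qed
  also have "\<dots> = (\<Sum>A\<in>level V m. mlin c' A * (\<Sum>B | B \<in> level V (Suc m) \<and> A \<subseteq> B. mlin c B))"
    using sum_nested_swap[OF V, of "\<lambda>A B. mlin c B * mlin c' A" m "Suc m"]
    by (simp add: sum_distrib_left mult.commute)
  also have "\<dots> = (\<Sum>A\<in>level V m. mlin c' A * ((real (card V) - real m - real i) * mlin c A))"
    using V c by (intro sum.cong refl arg_cong2[where f = "(*)"] sum_above_harmonic) (auto simp: level_def)
  finally show ?thesis by (simp add: level_inner_def sum_distrib_left algebra_simps)
qed

text \<open>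
  Exchanging the two polynomials in \<open>level_inner_step\<close> gives a second relation between the inner
  products on levels \<open>m\<close> and \<open>m + 1\<close>. The determinant of the resulting linear system is
  \<open>(i - j) (n + 1 - i - j)\<close>, which is nonzero in the given range.
\<close>

lemma level_inner_orthogonal:
  assumes V: "finite V" and m: "m \<le> card V"
    and c: "homogeneous i c" "harmonic_coeffs V c" and c': "homogeneous j c'" "harmonic_coeffs V c'"
    and ij: "i \<noteq> j" "i + j \<le> card V"
  shows "level_inner V m c c' = 0"
proof -
  let ?s = "\<lambda>m. level_inner V m c c'"
  let ?n = "real (card V)"
  have rec: "(real (Suc m) - real j) * ?s (Suc m) = (?n - real m - real i) * ?s m"
            "(real (Suc m) - real i) * ?s (Suc m) = (?n - real m - real j) * ?s m" if "m < card V" for m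
    using level_inner_step[OF V that c c'(1)] level_inner_step[OF V that c' c(1)]
    by (simp_all add: level_inner_commute)
  have zero: "?s m = 0" if "m < card V" for m
  proof -
    \<comment> \<open>the determinant of the two relations in the unknowns \<open>?s m\<close> and \<open>?s (Suc m)\<close>\<close>
    define D where "D = (real i - real j) * (?n + 1 - real i - real j)"
    have "D * ?s m =
      (real (Suc m) - real j) * ((?n - real m - real j) * ?s m) -
      (real (Suc m) - real i) * ((?n - real m - real i) * ?s m)"
      by (simp add: D_def algebra_simps)
    also have "\<dots> = 0"
      using rec[OF that] by (simp only: rec[symmetric, OF that]) (simp add: algebra_simps)
    finally show ?thesis using ij by (simp add: D_def)
  qed
  show ?thesis
  proof (cases "m < card V")
    case False
    then obtain m' where m': "m = Suc m'" "m' < card V"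
      using m ij by (cases m) auto
    then show ?thesis using rec[OF m'(2)] zero[OF m'(2)] ij by auto
  qed (rule zero)
qed

text \<open>
  For equal polynomials the recurrence of \<open>level_inner_step\<close> is the one satisfied by
  \<open>r \<mapsto> (n - 2j choose r)\<close>. On the starting level \<open>j\<close> the polynomial takes the values \<open>c S\<close> themselves.
\<close>

lemma level_inner_norm:
  assumes V: "finite V" and c: "homogeneous j c" "harmonic_coeffs V c" and j: "2 * j \<le> card V"
    and r: "j + r \<le> card V"
  shows "level_inner V (j + r) c c = real ((card V - 2 * j) choose r) * (\<Sum>S\<in>level V j. (c S)\<^sup>2)"
  using r
proof (induction r)
  case 0
  have "mlin c S = c S" if "S \<in> level V j" for S
  proof -
    have fS: "finite S" using that V by (auto simp: level_def intro: finite_subset)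
    moreover have "level S j = {S}"
      using that fS by (auto simp: level_def dest: card_subset_eq)
    ultimately show ?thesis using c by (simp add: mlin_homogeneous)
  qed
  then show ?case by (simp add: level_inner_def power2_eq_square)
next
  case (Suc r)
  let ?W = "\<Sum>S\<in>level V j. (c S)\<^sup>2"
  have "(real (Suc r)) * level_inner V (j + Suc r) c c =
        (real (card V) - real (j + r) - real j) * level_inner V (j + r) c c"
    using level_inner_step[OF V _ c c(1), of "j + r"] Suc.prems by simp
  also have "\<dots> = (real (card V - 2 * j) - real r) * real ((card V - 2 * j) choose r) * ?W"
    using Suc j by (simp add: of_nat_diff)
  also have "(real (card V - 2 * j) - real r) * real ((card V - 2 * j) choose r) =
             real (Suc r) * real ((card V - 2 * j) choose Suc r)"
  proof (cases "r \<le> card V - 2 * j")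
    case True
    then show ?thesis
      using binomial_absorb_comp[of "card V - 2 * j" r] Suc_times_binomial_eq[of "card V - 2*j - 1" r]
      by (metis binomial_absorption of_nat_diff of_nat_mult)
  qed (simp add: binomial_eq_0)
  finally have "real (Suc r) * level_inner V (j + Suc r) c c =
      real (Suc r) * (real ((card V - 2 * j) choose Suc r) * ?W)"
    by (simp only: mult.assoc)
  then show ?case by (subst (asm) mult_left_cancel) auto
qed

lemma level_inner_below:
  assumes V: "finite V" and c: "homogeneous j c" and m: "m < j"
  shows "level_inner V m c c' = 0"
  unfolding level_inner_def
proof (intro sum.neutral ballI)
  fix A assume A: "A \<in> level V m"
  then have fA: "finite A" using V by (auto simp: level_def intro: finite_subset)
  then have "level A j = {}" using A m by (auto simp: level_def dest: card_mono)
  then show "mlin c A * mlin c' A = 0"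
    using c fA by (simp add: mlin_homogeneous)
qed

section \<open>The nested coupling of two levels\<close>

definition level_mean :: "'a set \<Rightarrow> nat \<Rightarrow> ('a set \<Rightarrow> real) \<Rightarrow> real" where
  "level_mean V m g = (\<Sum>A\<in>level V m. g A) / real (card V choose m)"

text \<open>
  The expectation of \<open>F A * F B\<close> for a uniformly random pair \<open>A \<subseteq> B\<close> of sizes \<open>a\<close> and \<open>b\<close>.
\<close>

definition nested_corr :: "'a set \<Rightarrow> nat \<Rightarrow> nat \<Rightarrow> ('a set \<Rightarrow> real) \<Rightarrow> real" where
  "nested_corr V a b F = (\<Sum>B\<in>level V b. \<Sum>A\<in>level B a. F A * F B) / (real (card V choose b) * real (b choose a))"

text \<open>
  The next two lemmas identify the marginals of the coupling: both are uniform.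
\<close>

lemma nested_mean_upper:
  assumes "finite V" "b \<le> card V" "a \<le> b"
  shows "(\<Sum>B\<in>level V b. \<Sum>A\<in>level B a. h B) / (real (card V choose b) * real (b choose a)) = level_mean V b h"
proof -
  have "(\<Sum>B\<in>level V b. \<Sum>A\<in>level B a. h B) = (\<Sum>B\<in>level V b. real (b choose a) * h B)"
    using assms by (intro sum.cong refl) (auto simp: level_def n_subsets finite_subset)
  then show ?thesis
    using assms by (simp add: level_mean_def sum_distrib_left[symmetric])
qed

lemma nested_mean_lower:
  assumes "finite V" "b \<le> card V" "a \<le> b"
  shows "(\<Sum>B\<in>level V b. \<Sum>A\<in>level B a. h A) / (real (card V choose b) * real (b choose a)) = level_mean V a h"
proof -
  have "real (card V choose b) * real (b choose a) = real ((card V - a) choose (card V - b)) * real (card V choose a)"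
    using sum_nested[OF assms(1,2), where a = a and h = "\<lambda>_. 1"] nested_mean_upper[OF assms, of "\<lambda>_. 1"] assms
    by (simp add: level_mean_def card_level field_simps)
  then show ?thesis
    using assms by (simp add: level_mean_def sum_nested)
qed

text \<open>
  This linearised form of the Cauchy--Schwarz inequality lets the averages over pairs and over levels be
  taken before the optimal \<open>\<delta>\<close> is inserted.
\<close>

lemma abs_le_square_mean:
  fixes t \<delta> :: real
  assumes "\<delta> > 0"
  shows "\<bar>t\<bar> \<le> (\<delta> + t\<^sup>2 / \<delta>) / 2"
proof -
  have "0 \<le> (\<bar>t\<bar> - \<delta>)\<^sup>2" by simp
  then have "2 * \<delta> * \<bar>t\<bar> \<le> \<delta>\<^sup>2 + t\<^sup>2" by (simp add: power2_diff algebra_simps)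
  then show ?thesis using assms by (simp add: field_simps power2_eq_square)
qed

text \<open>
  The bracket multiplying \<open>1 / \<delta>\<close> is the mean of \<open>(F A - F B)\<^sup>2\<close> under the nested coupling of levels
  \<open>a\<close> and \<open>b\<close>.
\<close>

lemma level_mean_lipschitz_diff:
  assumes V: "finite V" "b \<le> card V" "a \<le> b" and \<phi>: "1-lipschitz_on UNIV \<phi>" and \<delta>: "\<delta> > 0"
  shows "\<bar>level_mean V a (\<lambda>A. \<phi> (F A)) - level_mean V b (\<lambda>A. \<phi> (F A))\<bar> \<le>
    (\<delta> + (level_mean V a (\<lambda>A. (F A)\<^sup>2) + level_mean V b (\<lambda>A. (F A)\<^sup>2) - 2 * nested_corr V a b F) / \<delta>) / 2"
proof -
  define P where "P = real (card V choose b) * real (b choose a)"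
  have P: "P > 0" using V by (simp add: P_def)
  note up = nested_mean_upper[OF V, folded P_def] and low = nested_mean_lower[OF V, folded P_def]
  have one: "(\<Sum>B\<in>level V b. \<Sum>A\<in>level B a. 1) = P"
    using V up[of "\<lambda>_. 1"] P by (simp add: level_mean_def card_level)
  have "\<bar>level_mean V a (\<lambda>A. \<phi> (F A)) - level_mean V b (\<lambda>A. \<phi> (F A))\<bar> =
        \<bar>\<Sum>B\<in>level V b. \<Sum>A\<in>level B a. \<phi> (F A) - \<phi> (F B)\<bar> / P"
    using P by (simp add: sum_subtractf up[symmetric] low[symmetric] diff_divide_distrib[symmetric] abs_divide)
  also have "\<dots> \<le> (\<Sum>B\<in>level V b. \<Sum>A\<in>level B a. \<bar>\<phi> (F A) - \<phi> (F B)\<bar>) / P"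
    using P by (intro divide_right_mono order_trans[OF sum_abs] sum_mono) auto
  also have "\<dots> \<le> (\<Sum>B\<in>level V b. \<Sum>A\<in>level B a. (\<delta> + (F A - F B)\<^sup>2 / \<delta>) / 2) / P"
  proof (intro divide_right_mono sum_mono)
    fix A B
    have "\<bar>\<phi> (F A) - \<phi> (F B)\<bar> \<le> \<bar>F A - F B\<bar>"
      using lipschitz_onD[OF \<phi>, of "F A" "F B"] by (simp add: dist_real_def)
    also have "\<dots> \<le> (\<delta> + (F A - F B)\<^sup>2 / \<delta>) / 2" by (rule abs_le_square_mean[OF \<delta>])
    finally show "\<bar>\<phi> (F A) - \<phi> (F B)\<bar> \<le> (\<delta> + (F A - F B)\<^sup>2 / \<delta>) / 2" .
  qed (use P in auto)
  also have "(\<Sum>B\<in>level V b. \<Sum>A\<in>level B a. (\<delta> + (F A - F B)\<^sup>2 / \<delta>) / 2) =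
      (\<delta> * P + ((\<Sum>B\<in>level V b. \<Sum>A\<in>level B a. (F A)\<^sup>2) + (\<Sum>B\<in>level V b. \<Sum>A\<in>level B a. (F B)\<^sup>2)
       - 2 * (\<Sum>B\<in>level V b. \<Sum>A\<in>level B a. F A * F B)) / \<delta>) / 2"
    unfolding one[symmetric] sum_distrib_left sum.distrib[symmetric] sum_subtractf[symmetric] sum_divide_distrib
    by (intro sum.cong refl) (simp add: power2_diff algebra_simps)
  also have "\<dots> / P = (\<delta> + (level_mean V a (\<lambda>A. (F A)\<^sup>2) + level_mean V b (\<lambda>A. (F A)\<^sup>2) - 2 * nested_corr V a b F) / \<delta>) / 2"
    using P \<delta> unfolding up[symmetric] low[symmetric] nested_corr_def P_def[symmetric]
    by (simp add: field_simps)
  finally show ?thesis .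
qed

section \<open>Second moments through homogeneous parts\<close>

lemma homogeneous_part [simp]: "homogeneous j (homogeneous_part j c)"
  by (auto simp: homogeneous_def homogeneous_part_def)

lemma harmonic_homogeneous_part:
  assumes V: "finite V" and harm: "harmonic_coeffs V c"
  shows "harmonic_coeffs V (homogeneous_part j c)"
  unfolding harmonic_coeffs_def
proof (intro allI impI)
  fix T assume T: "T \<subseteq> V"
  have "(\<Sum>i\<in>V - T. homogeneous_part j c (insert i T)) =
        (\<Sum>i\<in>V - T. of_bool (Suc (card T) = j) * c (insert i T))"
    using finite_subset[OF T V] by (intro sum.cong) (auto simp: homogeneous_part_def)
  then show "(\<Sum>i\<in>V - T. homogeneous_part j c (insert i T)) = 0"
    using harm T by (simp add: harmonic_coeffs_def sum_distrib_left[symmetric])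
qed

lemma mlin_homogeneous_parts:
  assumes "\<And>S. c S \<noteq> 0 \<Longrightarrow> card S \<le> d"
  shows "mlin c A = (\<Sum>j\<le>d. mlin (homogeneous_part j c) A)"
proof -
  have "mlin c A = (\<Sum>S\<in>Pow A. \<Sum>j\<le>d. homogeneous_part j c S)"
    unfolding mlin_def using assms by (intro sum.cong) (auto simp: homogeneous_part_def)
  then show ?thesis by (simp add: mlin_def sum.swap[of _ "Pow A"])
qed

definition part_norm_sq :: "'a set \<Rightarrow> nat \<Rightarrow> ('a set \<Rightarrow> real) \<Rightarrow> nat \<Rightarrow> real" where
  "part_norm_sq V m c j = level_inner V m (homogeneous_part j c) (homogeneous_part j c)"

lemma part_norm_sq_nonneg: "part_norm_sq V m c j \<ge> 0"
  unfolding part_norm_sq_def level_inner_def by (intro sum_nonneg) auto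

lemma sum_level_times_part:
  assumes V: "finite V" and harm: "harmonic_coeffs V c"
    and deg: "\<And>S. c S \<noteq> 0 \<Longrightarrow> card S \<le> d" and d: "2 * d \<le> card V"
    and m: "m \<le> card V" and j: "j \<le> d"
  shows "(\<Sum>A\<in>level V m. mlin c A * mlin (homogeneous_part j c) A) = part_norm_sq V m c j"
proof -
  have parts: "mlin c A = (\<Sum>i\<le>d. mlin (homogeneous_part i c) A)" for A
    by (rule mlin_homogeneous_parts) (rule deg)
  have "(\<Sum>A\<in>level V m. mlin c A * mlin (homogeneous_part j c) A) =
        (\<Sum>i\<le>d. level_inner V m (homogeneous_part i c) (homogeneous_part j c))"
    unfolding level_inner_def parts sum_distrib_right by (rule sum.swap)
  also have "\<dots> = (\<Sum>i\<le>d. if i = j then part_norm_sq V m c j else 0)"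
  proof (intro sum.cong refl)
    fix i assume "i \<in> {..d}"
    then have "i + j \<le> card V" using j d by auto
    then show "level_inner V m (homogeneous_part i c) (homogeneous_part j c) =
               (if i = j then part_norm_sq V m c j else 0)"
      using V m harm by (auto simp: part_norm_sq_def intro!: level_inner_orthogonal harmonic_homogeneous_part)
  qed
  finally show ?thesis using j by simp
qed

lemma level_mean_square:
  assumes V: "finite V" and harm: "harmonic_coeffs V c"
    and deg: "\<And>S. c S \<noteq> 0 \<Longrightarrow> card S \<le> d" and d: "2 * d \<le> card V" and m: "m \<le> card V"
  shows "level_mean V m (\<lambda>A. (mlin c A)\<^sup>2) = (\<Sum>j\<le>d. part_norm_sq V m c j) / real (card V choose m)"
proof -
  have "(\<Sum>A\<in>level V m. (mlin c A)\<^sup>2) = (\<Sum>A\<in>level V m. \<Sum>j\<le>d. mlin c A * mlin (homogeneous_part j c) A)"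
    using mlin_homogeneous_parts[of c d, OF deg]
    by (intro sum.cong refl) (simp add: power2_eq_square sum_distrib_left[symmetric])
  also have "\<dots> = (\<Sum>j\<le>d. part_norm_sq V m c j)"
    by (subst sum.swap, intro sum.cong refl sum_level_times_part[OF V harm deg d m]) auto
  finally show ?thesis by (simp add: level_mean_def)
qed

text \<open>
  Averaging over the smaller set multiplies each homogeneous part by its eigenvalue; the cross terms
  that remain on the larger level vanish by orthogonality.
\<close>

lemma nested_corr_eq:
  assumes V: "finite V" and harm: "harmonic_coeffs V c"
    and deg: "\<And>S. c S \<noteq> 0 \<Longrightarrow> card S \<le> d" and d: "2 * d \<le> card V" and ab: "a \<le> b" "b \<le> card V"
  shows "nested_corr V a b (mlin c) =
    (\<Sum>j\<le>d. real ((b - j) choose (b - a)) * part_norm_sq V b c j) / (real (card V choose b) * real (b choose a))"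
proof -
  have "(\<Sum>B\<in>level V b. \<Sum>A\<in>level B a. mlin c A * mlin c B) =
        (\<Sum>B\<in>level V b. \<Sum>j\<le>d. real ((b - j) choose (b - a)) * (mlin c B * mlin (homogeneous_part j c) B))"
  proof (intro sum.cong refl)
    fix B assume B: "B \<in> level V b"
    then have fB: "finite B" "card B = b" using V by (auto simp: level_def intro: finite_subset)
    have "(\<Sum>A\<in>level B a. mlin c A) = (\<Sum>j\<le>d. \<Sum>A\<in>level B a. mlin (homogeneous_part j c) A)"
      by (subst sum.swap) (simp add: mlin_homogeneous_parts[of c d, OF deg, symmetric])
    also have "\<dots> = (\<Sum>j\<le>d. real ((b - j) choose (b - a)) * mlin (homogeneous_part j c) B)"
      using fB ab by (intro sum.cong refl) (subst sum_below_homogeneous, auto)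
    finally show "(\<Sum>A\<in>level B a. mlin c A * mlin c B) =
        (\<Sum>j\<le>d. real ((b - j) choose (b - a)) * (mlin c B * mlin (homogeneous_part j c) B))"
      by (simp add: sum_distrib_right[symmetric] sum_distrib_left mult_ac)
  qed
  also have "\<dots> = (\<Sum>j\<le>d. real ((b - j) choose (b - a)) * part_norm_sq V b c j)"
    by (subst sum.swap, intro sum.cong refl)
      (simp add: sum_distrib_left[symmetric] sum_level_times_part[OF V harm deg d ab(2)])
  finally show ?thesis by (simp add: nested_corr_def)
qed

section \<open>Lower bound for the correlation of two levels\<close>

text \<open>
  The quotient \<open>(a - j choose r) / (a choose r)\<close> is the probability that a random \<open>r\<close>-subset of an \<open>a\<close>-set
  avoids \<open>j\<close> given points, and this is a union bound over these points. In the formal proof the union bound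
  appears as \<open>j\<close> applications of Pascal's rule.
\<close>

lemma binomial_diff_lower_bound:
  assumes "j \<le> a" "0 < a"
  shows "real ((a - j) choose r) \<ge> (1 - real j * real r / real a) * real (a choose r)"
proof (cases r)
  case (Suc r')
  have "a choose r \<le> ((a - j) choose r) + j * ((a - 1) choose r')"
    using assms(1)
  proof (induction j)
    case (Suc j)
    then obtain m where m: "a - j = Suc m" "a - Suc j = m" by (cases "a - j") auto
    have "((a - j) choose r) = (m choose r) + (m choose r')"
      by (simp add: m \<open>r = Suc r'\<close>)
    moreover have "(m choose r') \<le> ((a - 1) choose r')"
      by (rule binomial_right_mono) (use m in auto)
    ultimately show ?case using Suc m by simp
  qed simp
  then have "real (a choose r) \<le> real ((a - j) choose r) + real j * real ((a - 1) choose r')"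
    by (metis of_nat_add of_nat_le_iff of_nat_mult)
  moreover have "real r * real (a choose r) = real a * real ((a - 1) choose r')"
    using binomial_absorption[of r' a] Suc by (metis of_nat_mult)
  then have "real ((a - 1) choose r') = real r * real (a choose r) / real a"
    using assms by (simp add: field_simps)
  ultimately show ?thesis by (simp add: algebra_simps)
qed simp

lemma part_norm_sq_eq:
  assumes V: "finite V" and harm: "harmonic_coeffs V c"
    and j: "2 * j \<le> card V" and m: "j \<le> m" "m \<le> card V"
  shows "part_norm_sq V m c j = real ((card V - 2 * j) choose (m - j)) * (\<Sum>S\<in>level V j. (homogeneous_part j c S)\<^sup>2)"
  using level_inner_norm[OF V homogeneous_part harmonic_homogeneous_part[OF V harm], of j "m - j"] assms
  by (simp add: part_norm_sq_def)

lemma part_norm_sq_below: "finite V \<Longrightarrow> m < j \<Longrightarrow> part_norm_sq V m c j = 0"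
  by (simp add: part_norm_sq_def level_inner_below[OF _ homogeneous_part])

text \<open>
  For \<open>k \<le> l\<close> the formula of \<open>nested_corr_eq\<close> refers to second moments on level \<open>l\<close>. This
  expresses them through level \<open>k\<close>; the factor that appears is the eigenvalue for passing from level
  \<open>k\<close> up to level \<open>l\<close>.
\<close>

lemma part_norm_sq_upper:
  assumes V: "finite V" and harm: "harmonic_coeffs V c"
    and j: "2 * j \<le> card V" "j \<le> k" "j \<le> card V - k" and kl: "k \<le> l" "l \<le> card V"
  shows "real ((l - j) choose (l - k)) * part_norm_sq V l c j / (real (card V choose l) * real (l choose k)) =
    real ((card V - k - j) choose (l - k)) / real ((card V - k) choose (l - k)) *
    (part_norm_sq V k c j / real (card V choose k))"
proof -
  define n where "n = card V"
  define W where "W = (\<Sum>S\<in>level V j. (homogeneous_part j c S)\<^sup>2)"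
  have num: "((n - 2 * j) choose (l - j)) * ((l - j) choose (l - k)) =
             ((n - 2 * j) choose (k - j)) * ((n - k - j) choose (l - k))"
  proof (cases "l - j \<le> n - 2 * j")
    case True
    have "(l - j) choose (l - k) = (l - j) choose (k - j)"
      using binomial_symmetric[of "k - j" "l - j"] kl j by simp
    moreover have "n - 2 * j - (k - j) = n - k - j" "l - j - (k - j) = l - k"
      using j kl by (auto simp: n_def)
    ultimately show ?thesis using choose_mult[of "k - j" "l - j" "n - 2 * j"] True diff_le_mono[OF kl(1), of j]
      by metis
  next
    case False
    then have "l - k > n - k - j" using j kl by (auto simp: n_def)
    with False show ?thesis by (simp add: binomial_eq_0)
  qed
  have den: "(n choose l) * (l choose k) = (n choose k) * ((n - k) choose (l - k))"
    using kl by (intro choose_mult) (auto simp: n_def)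
  have "real ((l - j) choose (l - k)) * part_norm_sq V l c j =
        real (((n - 2 * j) choose (l - j)) * ((l - j) choose (l - k))) * W"
    using part_norm_sq_eq[OF V harm j(1), of l] j kl by (simp add: n_def W_def)
  also have "\<dots> = real ((n - k - j) choose (l - k)) * part_norm_sq V k c j"
    unfolding num using part_norm_sq_eq[OF V harm j(1), of k] j kl by (simp add: n_def W_def)
  finally have "real ((l - j) choose (l - k)) * part_norm_sq V l c j / (real ((n choose l) * (l choose k))) =
    real ((n - k - j) choose (l - k)) * part_norm_sq V k c j / (real ((n choose k) * ((n - k) choose (l - k))))"
    by (simp only: den)
  then show ?thesis by (simp add: n_def)
qed

text \<open>
  The eigenvalue from level \<open>k\<close> to level \<open>l\<close> is \<open>(k - j choose k - l) / (k choose k - l)\<close> for \<open>l \<le> k\<close> and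
  \<open>(n - k - j choose l - k) / (n - k choose l - k)\<close> for \<open>l \<ge> k\<close>. By \<open>binomial_diff_lower_bound\<close> these are at least
  \<open>1 - j |l - k| / k\<close> and \<open>1 - j |l - k| / (n - k)\<close>, and both bounds are weakened to a common one with
  \<open>1 / \<sigma> = 1 / k + 1 / (n - k)\<close>. For \<open>k = p n\<close> the number \<open>\<sigma>\<close> is the binomial variance \<open>p (1 - p) n\<close>.
\<close>

lemma nested_corr_lower_bound:
  assumes V: "finite V" and harm: "harmonic_coeffs V c"
    and deg: "\<And>S. c S \<noteq> 0 \<Longrightarrow> card S \<le> d" and d: "d \<le> k" "d \<le> card V - k" and k: "0 < k" "k < card V"
    and l: "l \<le> card V"
    and \<sigma>: "\<sigma> * real (card V) = real k * real (card V - k)"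
  shows "nested_corr V (min k l) (max k l) (mlin c) \<ge>
    (\<Sum>j\<le>d. part_norm_sq V k c j / real (card V choose k) * (1 - real j * \<bar>real l - real k\<bar> / \<sigma>))"
proof -
  define n where "n = card V"
  have inv: "1 / \<sigma> = 1 / real k + 1 / real (n - k)"
  proof -
    have "real k * real (n - k) > 0" using k by (simp add: n_def)
    then have "\<sigma> > 0" using \<sigma> k by (metis n_def of_nat_0_less_iff zero_less_mult_pos2 less_trans)
    moreover have "real n = real k + real (n - k)" using k by (simp add: n_def)
    ultimately show ?thesis using \<sigma> k by (simp add: field_simps n_def)
  qed
  have d2: "2 * d \<le> card V" using d by simp
  have le: "1 - real j * \<bar>real l - real k\<bar> / \<sigma> \<le> 1 - real j * r / x"
    if "x = real k \<or> x = real (n - k)" "r = \<bar>real l - real k\<bar>" for j x r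
  proof -
    have "1 / x \<le> 1 / \<sigma>" unfolding inv using that by auto
    then have "(real j * r) * (1 / x) \<le> (real j * r) * (1 / \<sigma>)"
      using that by (intro mult_left_mono) auto
    then show ?thesis using that by simp
  qed
  show ?thesis
  proof (cases "l \<le> k")
    case True
    have "nested_corr V (min k l) (max k l) (mlin c) = nested_corr V l k (mlin c)"
      using True by (simp add: min_def max_def)
    also have "\<dots> = (\<Sum>j\<le>d. part_norm_sq V k c j / real (card V choose k) *
                         (real ((k - j) choose (k - l)) / real (k choose (k - l))))"
      using nested_corr_eq[OF V harm deg d2 True] k binomial_symmetric[OF True]
      by (simp add: sum_divide_distrib mult_ac)
    also have "\<dots> \<ge> (\<Sum>j\<le>d. part_norm_sq V k c j / real (card V choose k) * (1 - real j * \<bar>real l - real k\<bar> / \<sigma>))"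
    proof (intro sum_mono mult_left_mono)
      fix j assume j: "j \<in> {..d}"
      have "1 - real j * \<bar>real l - real k\<bar> / \<sigma> \<le> 1 - real j * real (k - l) / real k"
        by (rule le) (use True in \<open>auto simp: of_nat_diff\<close>)
      also have "\<dots> \<le> real ((k - j) choose (k - l)) / real (k choose (k - l))"
        using binomial_diff_lower_bound[of j k "k - l"] j d k by (simp add: le_divide_eq)
      finally show "1 - real j * \<bar>real l - real k\<bar> / \<sigma> \<le> real ((k - j) choose (k - l)) / real (k choose (k - l))" .
    qed (auto simp: part_norm_sq_nonneg)
    finally show ?thesis .
  next
    case False
    then have kl: "k \<le> l" by simp
    have "nested_corr V (min k l) (max k l) (mlin c) = nested_corr V k l (mlin c)"
      using kl by (simp add: min_def max_def)
    also have "\<dots> = (\<Sum>j\<le>d. real ((l - j) choose (l - k)) * part_norm_sq V l c j) /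
                         (real (card V choose l) * real (l choose k))"
      by (rule nested_corr_eq[OF V harm _ d2 kl l]) (rule deg)
    also have "\<dots> = (\<Sum>j\<le>d. part_norm_sq V k c j / real (card V choose k) *
                         (real ((n - k - j) choose (l - k)) / real ((n - k) choose (l - k))))"
      unfolding sum_divide_distrib
    proof (intro sum.cong refl)
      fix j assume "j \<in> {..d}"
      then have "2 * j \<le> card V" "j \<le> k" "j \<le> card V - k" using d2 d by auto
      from part_norm_sq_upper[OF V harm this kl l]
      show "real ((l - j) choose (l - k)) * part_norm_sq V l c j / (real (card V choose l) * real (l choose k)) =
            part_norm_sq V k c j / real (card V choose k) *
                         (real ((n - k - j) choose (l - k)) / real ((n - k) choose (l - k)))"
        by (simp add: n_def mult_ac)
    qed
    also have "\<dots> \<ge> (\<Sum>j\<le>d. part_norm_sq V k c j / real (card V choose k) * (1 - real j * \<bar>real l - real k\<bar> / \<sigma>))"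
    proof (intro sum_mono mult_left_mono)
      fix j assume j: "j \<in> {..d}"
      have "1 - real j * \<bar>real l - real k\<bar> / \<sigma> \<le> 1 - real j * real (l - k) / real (n - k)"
        by (rule le) (use kl in \<open>auto simp: of_nat_diff\<close>)
      also have "\<dots> \<le> real ((n - k - j) choose (l - k)) / real ((n - k) choose (l - k))"
        using binomial_diff_lower_bound[of j "n - k" "l - k"] j d k l by (simp add: le_divide_eq n_def)
      finally show "1 - real j * \<bar>real l - real k\<bar> / \<sigma> \<le> real ((n - k - j) choose (l - k)) / real ((n - k) choose (l - k))" .
    qed (auto simp: part_norm_sq_nonneg)
    finally show ?thesis .
  qed
qed

section \<open>Binomial averages\<close>

text \<open>
  The Bernstein polynomials are the weights of the binomial distribution, whose mean absolute
  deviation is bounded by its standard deviation.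
\<close>

lemma Bernstein_abs_deviation:
  assumes "0 < p" "p < 1" "n > 0"
  shows "(\<Sum>l\<le>n. Bernstein n l p * \<bar>real l - real n * p\<bar>) \<le> sqrt (p * (1 - p) * real n)"
proof -
  define s where "s = sqrt (p * (1 - p) * real n)"
  have s: "s > 0" "s\<^sup>2 = p * (1 - p) * real n" using assms by (simp_all add: s_def)
  have "(\<Sum>l\<le>n. Bernstein n l p * (real l - real n * p)\<^sup>2) =
        (\<Sum>l\<le>n. real l * (real l - 1) * Bernstein n l p) +
        (1 - 2 * real n * p) * (\<Sum>l\<le>n. real l * Bernstein n l p) + (real n * p)\<^sup>2 * (\<Sum>l\<le>n. Bernstein n l p)"
    unfolding sum_distrib_left sum.distrib[symmetric]
    by (intro sum.cong refl) (simp add: power2_eq_square algebra_simps)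
  also have "\<dots> = s\<^sup>2" unfolding s(2) sum_kk_Bernstein sum_k_Bernstein sum_Bernstein by (simp add: power2_eq_square algebra_simps)
  finally have var: "(\<Sum>l\<le>n. Bernstein n l p * (real l - real n * p)\<^sup>2) = s\<^sup>2" .
  have "(\<Sum>l\<le>n. Bernstein n l p * \<bar>real l - real n * p\<bar>) \<le>
        (\<Sum>l\<le>n. Bernstein n l p * ((s + (real l - real n * p)\<^sup>2 / s) / 2))"
    using assms by (intro sum_mono mult_left_mono abs_le_square_mean s Bernstein_nonneg) auto
  also have "\<dots> = (s * (\<Sum>l\<le>n. Bernstein n l p) + (\<Sum>l\<le>n. Bernstein n l p * (real l - real n * p)\<^sup>2) / s) / 2"
    unfolding sum_distrib_left sum_divide_distrib sum.distrib[symmetric]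
    by (intro sum.cong refl) (simp add: algebra_simps)
  also have "\<dots> = s" unfolding var using s(1) by (simp add: power2_eq_square)
  finally show ?thesis by (simp add: s_def)
qed

text \<open>
  For \<open>k = p n\<close> one has \<open>\<sigma> / n = p (1 - p)\<close>, and the lemma compares the second moment of a
  homogeneous part on level \<open>k\<close> with that under the product measure. Passing from \<open>j\<close> to \<open>j + 1\<close>
  multiplies \<open>(n - 2j choose k - j)\<close> by \<open>t * \<sigma> / n\<close>, where
  \<open>t \<ge> (1 - j / k) (1 - j / (n - k)) \<ge> 1 - j / \<sigma>\<close>. The product of these factors loses at most
  \<open>(\<Sum>i<j. i / \<sigma>) \<le> j\<^sup>2 / (2 \<sigma>)\<close>.
\<close>

lemma binomial_centered_ratio:
  assumes k: "0 < k" "k < n" and \<sigma>: "\<sigma> * real n = real k * real (n - k)"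
    and j: "(real j)\<^sup>2 \<le> \<sigma>" "j \<le> k" "j \<le> n - k"
  shows "real ((n - 2 * j) choose (k - j)) \<ge> (1 - (real j)\<^sup>2 / (2 * \<sigma>)) * (\<sigma> / real n) ^ j * real (n choose k)"
  using j
proof (induction j)
  case (Suc j)
  have "real k * real (n - k) > 0" using k by simp
  then have \<sigma>0: "\<sigma> > 0" using \<sigma> k by (metis of_nat_0_less_iff zero_less_mult_pos2 less_trans)
  define N K where "N = n - 2 * j" and "K = k - j"
  define t where "t = real K * real (N - K) / (real N * (real N - 1)) / (\<sigma> / real n)"
  have NK: "0 < K" "K < N" "N - K = n - k - j" using Suc.prems k by (auto simp: N_def K_def)
  \<comment> \<open>both \<open>a\<close> and \<open>b\<close> below are absorption identities; together they remove two elements from the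
    ground set and one from the chosen subset\<close>
  have step: "real ((n - 2 * Suc j) choose (k - Suc j)) = t * (\<sigma> / real n) * real (N choose K)"
  proof -
    have "K * (N choose K) = N * ((N - 1) choose (K - 1))"
      using binomial_absorption[of "K - 1" N] NK by simp
    then have a: "real K * real (N choose K) = real N * real ((N - 1) choose (K - 1))"
      by (metis of_nat_mult)
    have "(N - 1 - (K - 1)) * ((N - 1) choose (K - 1)) = (N - 1) * ((N - 1 - 1) choose (K - 1))"
      by (rule binomial_absorb_comp)
    moreover have "N - 1 - (K - 1) = N - K" using NK by simp
    ultimately have b: "real (N - K) * real ((N - 1) choose (K - 1)) = (real N - 1) * real ((N - 2) choose (K - 1))"
      using NK by (metis (no_types, lifting) Suc_1 diff_Suc_eq_diff_pred of_nat_mult of_nat_diff of_nat_1 Suc_leI gr_implies_not0 not_gr0 One_nat_def)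
    have N1: "real N - 1 > 0" "real N > 0" using NK by auto
    have "real N * ((real N - 1) * real ((N - 2) choose (K - 1))) = real K * real (N - K) * real (N choose K)"
      unfolding b[symmetric] using a by (simp add: mult_ac)
    then have "real ((N - 2) choose (K - 1)) = real K * real (N - K) * real (N choose K) / (real N * (real N - 1))"
      using N1 by (simp add: field_simps)
    also have "\<dots> = t * (\<sigma> / real n) * real (N choose K)"
      using \<sigma>0 k by (simp add: t_def)
    also have "(N - 2) choose (K - 1) = (n - 2 * Suc j) choose (k - Suc j)"
      by (simp add: N_def K_def diff_diff_add)
    finally show ?thesis .
  qed
  have t: "t \<ge> 1 - real j / \<sigma>"
  proof -
    have N1: "real N - 1 > 0" "real N > 0" using NK by auto
    have Nn: "real N * (real N - 1) \<le> real n * real n"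
      using N1 by (intro mult_mono) (auto simp: N_def)
    have factors: "(1 - a / x) * (1 - a / y) = 1 - a * (x + y) / (x * y) + a * a / (x * y)"
      "(1 - a / x) * (1 - a / y) = (x - a) * (y - a) / (x * y)" if "x > 0" "y > 0" for a x y :: real
      using that by (simp_all add: field_simps)
    have "1 - real j / \<sigma> \<le> (1 - real j / real k) * (1 - real j / real (n - k))"
    proof -
      have "(1 - real j / real k) * (1 - real j / real (n - k)) =
            1 - real j * (real k + real (n - k)) / (real k * real (n - k)) + real j * real j / (real k * real (n - k))"
        using factors(1)[of "real k" "real (n - k)"] k by simp
      also have "real j * (real k + real (n - k)) / (real k * real (n - k)) = real j / \<sigma>"
        unfolding \<sigma>[symmetric] using k \<sigma>0 by (simp add: of_nat_diff)
      finally show ?thesis by simp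
    qed
    also have "\<dots> = real K * real (N - K) / (real n * real n) / (\<sigma> / real n)"
    proof -
      have "(1 - real j / real k) * (1 - real j / real (n - k)) = (real k - real j) * (real (n - k) - real j) / (\<sigma> * real n)"
        unfolding \<sigma> using factors(2)[of "real k" "real (n - k)"] k by simp
      also have "\<dots> = real K * real (N - K) / (\<sigma> * real n)"
        using Suc.prems NK by (simp add: K_def of_nat_diff)
      finally show ?thesis using k \<sigma>0 by simp
    qed
    also have "\<dots> \<le> t"
      unfolding t_def using N1 k \<sigma>0 Nn by (intro divide_right_mono divide_left_mono) auto
    finally show ?thesis .
  qed
  have j2: "(real j)\<^sup>2 \<le> \<sigma>" "real j \<le> \<sigma>"
  proof -
    show "(real j)\<^sup>2 \<le> \<sigma>" by (rule order_trans[OF _ Suc.prems(1)]) (simp add: power_mono)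
    have "real j \<le> real (Suc j) * real (Suc j)" by (simp add: algebra_simps)
    then show "real j \<le> \<sigma>" using Suc.prems(1) by (simp add: power2_eq_square)
  qed
  define u where "u = (real j)\<^sup>2 / (2 * \<sigma>)"
  define v where "v = real j / \<sigma>"
  have uv: "0 \<le> u" "u \<le> 1" "0 \<le> v" "v \<le> 1" using j2 \<sigma>0 by (simp_all add: u_def v_def)
  have "1 - (real (Suc j))\<^sup>2 / (2 * \<sigma>) \<le> 1 - u - v"
    using \<sigma>0 by (simp add: u_def v_def field_simps power2_eq_square)
  also have "\<dots> \<le> (1 - v) * (1 - u)" using uv by (simp add: algebra_simps)
  finally have "1 - (real (Suc j))\<^sup>2 / (2 * \<sigma>) \<le> (1 - v) * (1 - u)" .
  then have "(1 - (real (Suc j))\<^sup>2 / (2 * \<sigma>)) * (\<sigma> / real n) ^ Suc j * real (n choose k) \<le>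
        (1 - v) * (1 - u) * (\<sigma> / real n) ^ Suc j * real (n choose k)"
    using \<sigma>0 by (intro mult_right_mono) auto
  also have "\<dots> = (1 - v) * (\<sigma> / real n) * ((1 - u) * (\<sigma> / real n) ^ j * real (n choose k))"
    by simp
  also have "\<dots> \<le> (1 - v) * (\<sigma> / real n) * real (N choose K)"
    using Suc.IH j2 Suc.prems uv \<sigma>0 by (intro mult_left_mono) (auto simp: u_def N_def K_def)
  also have "\<dots> \<le> t * (\<sigma> / real n) * real (N choose K)"
    using t \<sigma>0 by (intro mult_right_mono) (auto simp: v_def)
  finally show ?case unfolding step .
qed simp

text \<open>
  Only \<open>j \<le> l \<le> n - j\<close> contributes, and after factoring out \<open>(p (1 - p)) ^ j\<close> this is the total mass of a
  binomial distribution with \<open>n - 2j\<close> trials.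
\<close>

lemma binomial_sum_shifted:
  fixes p :: real
  assumes "2 * j \<le> n"
  shows "(\<Sum>l=j..n. p ^ l * (1 - p) ^ (n - l) * real ((n - 2 * j) choose (l - j))) = (p * (1 - p)) ^ j"
proof -
  have "(\<Sum>l=j..n. p ^ l * (1 - p) ^ (n - l) * real ((n - 2 * j) choose (l - j))) =
        (\<Sum>r\<le>n - j. p ^ (j + r) * (1 - p) ^ (n - (j + r)) * real ((n - 2 * j) choose r))"
    using assms by (intro sum.reindex_bij_witness[where i = "\<lambda>r. j + r" and j = "\<lambda>l. l - j"]) auto
  also have "\<dots> = (\<Sum>r\<le>n - 2 * j. p ^ (j + r) * (1 - p) ^ (n - (j + r)) * real ((n - 2 * j) choose r))"
    using assms by (intro sum.mono_neutral_right) (auto simp: binomial_eq_0)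
  also have "\<dots> = (\<Sum>r\<le>n - 2 * j. (p * (1 - p)) ^ j * Bernstein (n - 2 * j) r p)"
  proof (intro sum.cong refl)
    fix r assume "r \<in> {..n - 2 * j}"
    then have "n - (j + r) = j + (n - 2 * j - r)" using assms by auto
    then show "p ^ (j + r) * (1 - p) ^ (n - (j + r)) * real ((n - 2 * j) choose r) =
               (p * (1 - p)) ^ j * Bernstein (n - 2 * j) r p"
      by (simp add: Bernstein_def power_add power_mult_distrib)
  qed
  finally show ?thesis by (simp add: sum_distrib_left[symmetric])
qed

text \<open>
  A binomially distributed level with a uniform set on it is a set drawn from the product measure, so
  this is the second moment of a homogeneous part under that measure. The right-hand side agrees with
  the expansion into the orthogonal functions \<open>\<Prod>i\<in>S. (x\<^sub>i - p)\<close>, since a harmonic polynomial does not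
  change when \<open>p\<close> is subtracted from all variables.
\<close>

lemma Bernstein_part_norm_sq:
  assumes V: "finite V" and harm: "harmonic_coeffs V c" and j: "2 * j \<le> card V"
  shows "(\<Sum>l\<le>card V. Bernstein (card V) l p * (part_norm_sq V l c j / real (card V choose l))) =
         (p * (1 - p)) ^ j * (\<Sum>S\<in>level V j. (homogeneous_part j c S)\<^sup>2)"
proof -
  define n where "n = card V"
  define W where "W = (\<Sum>S\<in>level V j. (homogeneous_part j c S)\<^sup>2)"
  have "(\<Sum>l\<le>n. Bernstein n l p * (part_norm_sq V l c j / real (n choose l))) =
        (\<Sum>l\<le>n. p ^ l * (1 - p) ^ (n - l) * part_norm_sq V l c j)"
    by (intro sum.cong refl) (simp add: Bernstein_def)
  also have "\<dots> = (\<Sum>l=j..n. p ^ l * (1 - p) ^ (n - l) * part_norm_sq V l c j)"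
    using V by (intro sum.mono_neutral_right) (auto simp: part_norm_sq_below)
  also have "\<dots> = (\<Sum>l=j..n. p ^ l * (1 - p) ^ (n - l) * real ((n - 2 * j) choose (l - j)) * W)"
    using part_norm_sq_eq[OF V harm j] by (intro sum.cong refl) (simp add: n_def W_def)
  also have "\<dots> = (p * (1 - p)) ^ j * W"
    using j by (simp add: sum_distrib_right[symmetric] binomial_sum_shifted n_def)
  finally show ?thesis by (simp add: n_def W_def)
qed

lemma part_norm_sq_Bernstein_le:
  assumes V: "finite V" and harm: "harmonic_coeffs V c" and p: "0 < p" "p < 1"
    and k: "p * real (card V) = real k" and \<sigma>: "\<sigma> = p * (1 - p) * real (card V)"
    and k0: "0 < k" "k < card V"
    and j: "(real j)\<^sup>2 \<le> \<sigma>" "j \<le> k" "j \<le> card V - k"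
  shows "(\<Sum>l\<le>card V. Bernstein (card V) l p * (part_norm_sq V l c j / real (card V choose l))) \<le>
         (1 + (real j)\<^sup>2 / \<sigma>) * (part_norm_sq V k c j / real (card V choose k))"
proof -
  define n where "n = card V"
  define W where "W = (\<Sum>S\<in>level V j. (homogeneous_part j c S)\<^sup>2)"
  define u where "u = (real j)\<^sup>2 / (2 * \<sigma>)"
  have n0: "n > 0" using k0 by (simp add: n_def)
  have \<sigma>0: "\<sigma> > 0" using p n0 by (simp add: \<sigma> n_def)
  have j2: "2 * j \<le> card V" using j k0 by simp
  have nk: "real (n - k) = (1 - p) * real n"
    using k k0 by (simp add: n_def of_nat_diff algebra_simps)
  have \<sigma>n: "\<sigma> * real n = real k * real (n - k)" "\<sigma> / real n = p * (1 - p)"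
    unfolding nk using k n0 by (simp_all add: \<sigma> n_def[symmetric])
  have u: "0 \<le> u" "2 * u \<le> 1" using j \<sigma>0 by (simp_all add: u_def)
  have ratio: "(1 - u) * (p * (1 - p)) ^ j * real (n choose k) \<le> real ((n - 2 * j) choose (k - j))"
    using binomial_centered_ratio[OF k0(1) _ \<sigma>n(1) j(1,2)] j k0
    by (simp add: \<sigma>n(2)[unfolded n_def] u_def n_def)
  have W: "W \<ge> 0" unfolding W_def by (intro sum_nonneg) auto
  have "u * (2 * u) \<le> u * 1" using u by (intro mult_left_mono) auto
  then have "1 \<le> (1 + 2 * u) * (1 - u)" by (simp add: algebra_simps)
  then have "(p * (1 - p)) ^ j * real (n choose k) \<le>
        (1 + 2 * u) * (1 - u) * ((p * (1 - p)) ^ j * real (n choose k))"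
    using mult_right_mono[of 1 "(1 + 2 * u) * (1 - u)" "(p * (1 - p)) ^ j * real (n choose k)"] p by simp
  also have "\<dots> = (1 + 2 * u) * ((1 - u) * (p * (1 - p)) ^ j * real (n choose k))" by simp
  also have "\<dots> \<le> (1 + 2 * u) * real ((n - 2 * j) choose (k - j))"
    using ratio u by (intro mult_left_mono) auto
  finally have "(p * (1 - p)) ^ j * real (n choose k) * W \<le> (1 + 2 * u) * real ((n - 2 * j) choose (k - j)) * W"
    using W by (intro mult_right_mono)
  moreover have "real (n choose k) > 0" using k0 by (simp add: n_def)
  ultimately have "(p * (1 - p)) ^ j * W \<le> (1 + 2 * u) * (real ((n - 2 * j) choose (k - j)) * W / real (n choose k))"
    by (simp add: field_simps)
  then show ?thesis
    using Bernstein_part_norm_sq[OF V harm j2, of p] part_norm_sq_eq[OF V harm j2 j(2)] k0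
    by (simp add: u_def W_def n_def)
qed

section \<open>Comparison of a level with the binomial mixture of levels\<close>

lemma mlin_homogeneous_0:
  assumes "finite A" "homogeneous 0 c"
  shows "mlin c A = c {}"
proof -
  have "level A 0 = {{}}" using assms(1) by (auto simp: level_def finite_subset)
  then show ?thesis by (simp add: mlin_homogeneous[OF assms])
qed

lemma mlin_homogeneous_part_0: "finite A \<Longrightarrow> mlin (homogeneous_part 0 c) A = c {}"
  by (simp add: mlin_homogeneous_0 homogeneous_part_def)

text \<open>
  The constant polynomial \<open>1\<close> is harmonic and homogeneous of degree \<open>0\<close>. Orthogonality to it shows that
  the parts of positive degree have mean \<open>0\<close>, so the variance is the sum of their second
  moments.
\<close>

lemma level_variance:
  assumes V: "finite V" and harm: "harmonic_coeffs V c"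
    and deg: "\<And>S. c S \<noteq> 0 \<Longrightarrow> card S \<le> d" and d: "2 * d \<le> card V" and m: "m \<le> card V"
  shows "level_mean V m (\<lambda>A. (mlin c A)\<^sup>2) - (level_mean V m (mlin c))\<^sup>2 =
         (\<Sum>j=1..d. part_norm_sq V m c j / real (card V choose m))"
proof -
  define e :: "'a set \<Rightarrow> real" where "e S = of_bool (S = {})" for S
  have e: "homogeneous 0 e" "harmonic_coeffs V e"
    by (auto simp: homogeneous_def harmonic_coeffs_def e_def)
  have fin: "finite A" if "A \<in> level V m" for A
    using that V by (auto simp: level_def intro: finite_subset)
  have one: "mlin e A = 1" if "A \<in> level V m" for A
    using that e fin by (simp add: mlin_homogeneous_0) (simp add: e_def)
  have cpos: "real (card V choose m) > 0" using m by simp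
  have "(\<Sum>A\<in>level V m. mlin c A) = (\<Sum>j\<le>d. level_inner V m (homogeneous_part j c) e)"
    unfolding level_inner_def
    by (subst sum.swap, intro sum.cong refl)
      (simp add: one mlin_homogeneous_parts[of c d, OF deg])
  also have "\<dots> = level_inner V m (homogeneous_part 0 c) e"
  proof -
    have "level_inner V m (homogeneous_part j c) e = 0" if "j \<in> {..d} - {0}" for j
      using that d V m e harm by (intro level_inner_orthogonal harmonic_homogeneous_part) auto
    then show ?thesis by (subst sum.remove[of _ 0]) auto
  qed
  also have "\<dots> = real (card V choose m) * c {}"
    using V by (simp add: level_inner_def one fin mlin_homogeneous_part_0 card_level)
  finally have mean: "level_mean V m (mlin c) = c {}"
    using cpos by (simp add: level_mean_def)
  have "part_norm_sq V m c 0 = real (card V choose m) * (c {})\<^sup>2"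
    using V by (simp add: part_norm_sq_def level_inner_def fin mlin_homogeneous_part_0 card_level power2_eq_square)
  then have "level_mean V m (\<lambda>A. (mlin c A)\<^sup>2) = (c {})\<^sup>2 + (\<Sum>j=1..d. part_norm_sq V m c j / real (card V choose m))"
    using cpos level_mean_square[of V c d m, OF V harm deg d m]
    by (simp add: atMost_atLeast0 sum.atLeast_Suc_atMost sum_divide_distrib add_divide_distrib)
  then show ?thesis by (simp add: mean)
qed

text \<open>
  The invariance principle in terms of set functions. With \<open>\<delta> = 2 sqrt (d / s)\<close>, each level \<open>l\<close> is
  compared with level \<open>k\<close> by the nested coupling, and the quadratic terms are averaged over \<open>l\<close>. The facts
  \<open>MB\<close> and \<open>RB\<close> in the proof estimate the second moment under the mixture and the averaged correlation.
  The constant part contributes nothing, because all errors are proportional to the degree \<open>j\<close>.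
\<close>

theorem level_binomial_invariance:
  assumes V: "finite V" and harm: "harmonic_coeffs V c"
    and deg: "\<And>S. c S \<noteq> 0 \<Longrightarrow> card S \<le> d"
    and p: "0 < p" "p < 1" and k: "p * real (card V) = real k"
    and s: "s = sqrt (p * (1 - p) * real (card V))" and d: "real d \<le> s"
    and var: "level_mean V k (\<lambda>A. (mlin c A)\<^sup>2) - (level_mean V k (mlin c))\<^sup>2 = 1"
    and \<phi>: "1-lipschitz_on UNIV \<phi>" and V0: "V \<noteq> {}"
  shows "\<bar>level_mean V k (\<lambda>A. \<phi> (mlin c A)) -
          (\<Sum>l\<le>card V. Bernstein (card V) l p * level_mean V l (\<lambda>A. \<phi> (mlin c A)))\<bar> \<le> 2 * sqrt (real d / s)"
proof -
  define n where "n = card V"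
  define \<sigma> where "\<sigma> = p * (1 - p) * real n"
  define F where "F = mlin c"
  define a where "a j = part_norm_sq V k c j / real (n choose k)" for j
  define B where "B l = Bernstein n l p" for l
  have n0: "n > 0" using V V0 by (simp add: n_def card_gt_0_iff)
  have k0: "0 < k" "k < n"
  proof -
    have "real k > 0" unfolding k[symmetric] using p n0 by (simp add: n_def)
    then show "0 < k" by simp
    have "real k < real n" unfolding k[symmetric] using p n0 by (simp add: n_def)
    then show "k < n" by simp
  qed
  have \<sigma>0: "\<sigma> > 0" using p n0 by (simp add: \<sigma>_def)
  have s0: "s > 0" and s2: "s * s = \<sigma>" using \<sigma>0 by (simp_all add: s \<sigma>_def n_def)
  have nk: "real (n - k) = (1 - p) * real n"
    using k k0 by (simp add: n_def of_nat_diff algebra_simps)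
  have \<sigma>n: "\<sigma> * real n = real k * real (n - k)"
    unfolding nk using k n0 by (simp add: \<sigma>_def n_def[symmetric])
  have d2: "(real d)\<^sup>2 \<le> \<sigma>"
    unfolding power2_eq_square s2[symmetric] using d s0 by (intro mult_mono) auto
  \<comment> \<open>the hypothesis on the degree gives \<open>d \<le> d\<^sup>2 \<le> \<sigma>\<close>, and \<open>\<sigma>\<close> is at most \<open>p n\<close> and \<open>(1 - p) n\<close>\<close>
  have dk: "d \<le> k" "d \<le> n - k"
  proof -
    have "real d \<le> (real d)\<^sup>2" by (cases d) (auto simp: power2_eq_square)
    also note d2
    finally have dle: "real d \<le> \<sigma>" .
    have "\<sigma> \<le> p * real n" unfolding \<sigma>_def using p by (simp add: mult_left_le_one_le)
    then have "real d \<le> real k" using dle k by (simp add: n_def)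
    then show "d \<le> k" by simp
    have "\<sigma> \<le> real (n - k)" unfolding nk \<sigma>_def using p by (simp add: mult_left_le_one_le)
    then show "d \<le> n - k" using dle by linarith
  qed
  have dn: "2 * d \<le> card V" using dk by (simp add: n_def)
  have B0: "B l \<ge> 0" for l using p by (simp add: B_def Bernstein_nonneg)
  have B1: "(\<Sum>l\<le>n. B l) = 1" by (simp add: B_def)
  have a0: "a j \<ge> 0" for j by (simp add: a_def part_norm_sq_nonneg)
  have var_a: "(\<Sum>j=1..d. a j) = 1"
    using level_variance[of V c d k, OF V harm deg dn] k0 var by (simp add: a_def n_def)
  \<comment> \<open>a constant polynomial cannot have variance 1; this makes \<open>\<delta>\<close> positive\<close>
  then have d1: "d \<ge> 1" by (cases d) auto
  define \<delta> where "\<delta> = 2 * sqrt (real d / s)"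
  have \<delta>: "\<delta> > 0" using d1 s0 by (simp add: \<delta>_def)
  define M where "M m = level_mean V m (\<lambda>A. (F A)\<^sup>2)" for m
  define E where "E m = level_mean V m (\<lambda>A. \<phi> (F A))" for m
  define R where "R l = nested_corr V (min k l) (max k l) F" for l
  have each: "\<bar>E k - E l\<bar> \<le> (\<delta> + (M k + M l - 2 * R l) / \<delta>) / 2" if "l \<le> n" for l
  proof (cases "k \<le> l")
    case True
    then show ?thesis
      using level_mean_lipschitz_diff[OF V _ True \<phi> \<delta>, of F] that
      by (simp add: E_def M_def R_def n_def)
  next
    case False
    then have "l \<le> k" by simp
    then show ?thesis
      using level_mean_lipschitz_diff[OF V _ \<open>l \<le> k\<close> \<phi> \<delta>, of F] k0
      by (simp add: E_def M_def R_def n_def abs_minus_commute add.commute)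
  qed
  have Mk: "M k = (\<Sum>j\<le>d. a j)"
    unfolding M_def F_def using level_mean_square[of V c d k, OF V harm deg dn] k0
    by (simp add: a_def n_def sum_divide_distrib)
  have MB: "(\<Sum>l\<le>n. B l * M l) \<le> (\<Sum>j\<le>d. (1 + real j / s) * a j)"
  proof -
    have "(\<Sum>l\<le>n. B l * M l) = (\<Sum>l\<le>n. \<Sum>j\<le>d. B l * (part_norm_sq V l c j / real (n choose l)))"
      unfolding M_def F_def using level_mean_square[of V c d, OF V harm deg dn]
      by (intro sum.cong refl) (simp add: n_def sum_divide_distrib sum_distrib_left)
    also have "\<dots> = (\<Sum>j\<le>d. \<Sum>l\<le>n. B l * (part_norm_sq V l c j / real (n choose l)))"
      by (rule sum.swap)
    also have "\<dots> \<le> (\<Sum>j\<le>d. (1 + real j / s) * a j)"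
    proof (intro sum_mono)
      fix j assume "j \<in> {..d}"
      then have j: "j \<le> d" by simp
      have j2: "(real j)\<^sup>2 \<le> \<sigma>"
        by (rule order_trans[OF _ d2]) (use j in \<open>simp add: power_mono\<close>)
      have "(\<Sum>l\<le>n. B l * (part_norm_sq V l c j / real (n choose l))) \<le> (1 + (real j)\<^sup>2 / \<sigma>) * a j"
        unfolding B_def a_def n_def
        using k0 j dk j2 by (intro part_norm_sq_Bernstein_le[OF V harm p k]) (auto simp: n_def \<sigma>_def)
      also have "\<dots> \<le> (1 + real j / s) * a j"
      proof (intro mult_right_mono add_left_mono a0)
        have "real j / s * (real j / s) \<le> real j / s * 1"
          using j d s0 by (intro mult_left_mono) auto
        then show "(real j)\<^sup>2 / \<sigma> \<le> real j / s"
          by (simp add: s2[symmetric] power2_eq_square)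
      qed
      finally show "(\<Sum>l\<le>n. B l * (part_norm_sq V l c j / real (n choose l))) \<le> (1 + real j / s) * a j" .
    qed
    finally show ?thesis .
  qed
  have RB: "(\<Sum>l\<le>n. B l * R l) \<ge> (\<Sum>j\<le>d. a j * (1 - real j / s))"
  proof -
    have "(\<Sum>j\<le>d. a j * (1 - real j / s)) \<le>
          (\<Sum>j\<le>d. a j * (1 - real j / \<sigma> * (\<Sum>l\<le>n. B l * \<bar>real l - real k\<bar>)))"
    proof (intro sum_mono mult_left_mono diff_left_mono a0)
      fix j
      have "(\<Sum>l\<le>n. B l * \<bar>real l - real k\<bar>) \<le> s"
        using Bernstein_abs_deviation[OF p n0] k by (simp add: B_def s n_def mult.commute)
      then have "real j / \<sigma> * (\<Sum>l\<le>n. B l * \<bar>real l - real k\<bar>) \<le> real j / \<sigma> * s"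
        using \<sigma>0 by (intro mult_left_mono) auto
      also have "\<dots> = real j / s" using s0 by (simp add: s2[symmetric])
      finally show "real j / \<sigma> * (\<Sum>l\<le>n. B l * \<bar>real l - real k\<bar>) \<le> real j / s" .
    qed
    also have "\<dots> = (\<Sum>j\<le>d. \<Sum>l\<le>n. B l * (a j * (1 - real j * \<bar>real l - real k\<bar> / \<sigma>)))"
    proof (intro sum.cong refl)
      fix j
      have "(\<Sum>l\<le>n. B l) - real j / \<sigma> * (\<Sum>l\<le>n. B l * \<bar>real l - real k\<bar>) =
            (\<Sum>l\<le>n. B l * (1 - real j * \<bar>real l - real k\<bar> / \<sigma>))"
        unfolding sum_distrib_left sum_subtractf[symmetric]
        by (intro sum.cong refl) (simp add: algebra_simps)
      then have "1 - real j / \<sigma> * (\<Sum>l\<le>n. B l * \<bar>real l - real k\<bar>) =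
            (\<Sum>l\<le>n. B l * (1 - real j * \<bar>real l - real k\<bar> / \<sigma>))"
        unfolding B1 .
      then show "a j * (1 - real j / \<sigma> * (\<Sum>l\<le>n. B l * \<bar>real l - real k\<bar>)) =
            (\<Sum>l\<le>n. B l * (a j * (1 - real j * \<bar>real l - real k\<bar> / \<sigma>)))"
        by (simp add: sum_distrib_left mult_ac)
    qed
    also have "\<dots> = (\<Sum>l\<le>n. B l * (\<Sum>j\<le>d. a j * (1 - real j * \<bar>real l - real k\<bar> / \<sigma>)))"
      by (subst sum.swap) (simp add: sum_distrib_left)
    also have "\<dots> \<le> (\<Sum>l\<le>n. B l * R l)"
    proof (intro sum_mono mult_left_mono B0)
      fix l assume "l \<in> {..n}"
      then show "(\<Sum>j\<le>d. a j * (1 - real j * \<bar>real l - real k\<bar> / \<sigma>)) \<le> R l"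
        unfolding R_def F_def a_def n_def
        using dk k0 \<sigma>n by (intro nested_corr_lower_bound V harm deg) (auto simp: n_def)
    qed
    finally show ?thesis .
  qed
  have total: "M k + (\<Sum>l\<le>n. B l * M l) - 2 * (\<Sum>l\<le>n. B l * R l) \<le> 3 * (real d / s)"
  proof -
    have "M k + (\<Sum>l\<le>n. B l * M l) - 2 * (\<Sum>l\<le>n. B l * R l) \<le>
          (\<Sum>j\<le>d. a j) + (\<Sum>j\<le>d. (1 + real j / s) * a j) - 2 * (\<Sum>j\<le>d. a j * (1 - real j / s))"
      using MB RB Mk by simp
    also have "\<dots> = (\<Sum>j\<le>d. 3 * (real j / s) * a j)"
      unfolding sum_distrib_left sum.distrib[symmetric] sum_subtractf[symmetric]
      by (intro sum.cong refl) (simp add: algebra_simps)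
    also have "\<dots> = (\<Sum>j=1..d. 3 * (real j / s) * a j)"
      by (rule sum.mono_neutral_right) auto
    also have "\<dots> \<le> (\<Sum>j=1..d. 3 * (real d / s) * a j)"
      using s0 a0 by (intro sum_mono mult_right_mono) (auto simp: divide_right_mono)
    also have "\<dots> = 3 * (real d / s)"
      unfolding sum_distrib_left[symmetric] var_a by simp
    finally show ?thesis .
  qed
  have "\<bar>E k - (\<Sum>l\<le>n. B l * E l)\<bar> = \<bar>\<Sum>l\<le>n. B l * (E k - E l)\<bar>"
    by (simp add: right_diff_distrib sum_subtractf sum_distrib_right[symmetric] B1)
  also have "\<dots> \<le> (\<Sum>l\<le>n. B l * \<bar>E k - E l\<bar>)"
    by (rule order_trans[OF sum_abs]) (simp add: abs_mult B0)
  also have "\<dots> \<le> (\<Sum>l\<le>n. B l * ((\<delta> + (M k + M l - 2 * R l) / \<delta>) / 2))"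
    by (intro sum_mono mult_left_mono B0 each) auto
  also have "\<dots> = (\<delta> * (\<Sum>l\<le>n. B l) + (M k * (\<Sum>l\<le>n. B l) + (\<Sum>l\<le>n. B l * M l) - 2 * (\<Sum>l\<le>n. B l * R l)) / \<delta>) / 2"
    unfolding sum_distrib_left sum_distrib_right sum_divide_distrib sum.distrib[symmetric] sum_subtractf[symmetric]
    by (intro sum.cong refl) (simp add: algebra_simps diff_divide_distrib add_divide_distrib)
  also have "\<dots> \<le> (\<delta> + (3 * (real d / s)) / \<delta>) / 2"
    unfolding B1 mult_1_right
    by (intro divide_right_mono add_left_mono total) (use \<delta> in auto)
  also have "\<dots> \<le> \<delta>"
  proof -
    have "\<delta> * \<delta> = 4 * (real d / s)" using s0 by (simp add: \<delta>_def)
    moreover have "real d / s \<ge> 0" using s0 by simp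
    ultimately have "3 * (real d / s) \<le> \<delta> * \<delta>" by linarith
    then have "3 * (real d / s) / \<delta> \<le> \<delta>" unfolding pos_divide_le_eq[OF \<delta>] .
    then show ?thesis by simp
  qed
  finally show ?thesis by (simp add: E_def F_def B_def n_def \<delta>_def)
qed

section \<open>Polynomials and measures on the cube\<close>

definition sqfree_monom :: "nat set \<Rightarrow> (nat \<Rightarrow>\<^sub>0 nat)" where
  "sqfree_monom S = (\<Sum>i\<in>S. Poly_Mapping.single i 1)"

definition sqfree_coeff :: "mpoly \<Rightarrow> nat set \<Rightarrow> real" where
  "sqfree_coeff f S = Poly_Mapping.lookup f (sqfree_monom S)"

definition char_point :: "nat \<Rightarrow> nat set \<Rightarrow> nat \<Rightarrow> real" where
  "char_point n A = (\<lambda>i\<in>{1..n}. of_bool (i \<in> A))"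

lemma lookup_sqfree_monom:
  "finite S \<Longrightarrow> Poly_Mapping.lookup (sqfree_monom S) i = of_bool (i \<in> S)"
  by (simp add: sqfree_monom_def lookup_sum lookup_single when_def)

lemma keys_sqfree_monom [simp]: "finite S \<Longrightarrow> Poly_Mapping.keys (sqfree_monom S) = S"
  by (auto simp: in_keys_iff lookup_sqfree_monom)

lemma sqfree_monom_keys:
  assumes "multilinear f" "m \<in> Poly_Mapping.keys f"
  shows "sqfree_monom (Poly_Mapping.keys m) = m"
proof (rule poly_mapping_eqI)
  fix i
  have "Poly_Mapping.lookup m i \<le> 1" using assms by (auto simp: multilinear_def)
  then show "Poly_Mapping.lookup (sqfree_monom (Poly_Mapping.keys m)) i = Poly_Mapping.lookup m i"
    by (auto simp: lookup_sqfree_monom in_keys_iff)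
qed

lemma eval_poly_char_point:
  assumes f: "multilinear f" "poly_in n f" and A: "A \<subseteq> {1..n}"
  shows "eval_poly f (char_point n A) = mlin (sqfree_coeff f) A"
proof -
  have fA: "finite A" using A finite_subset by auto
  have "eval_poly f (char_point n A) =
        (\<Sum>m\<in>Poly_Mapping.keys f. if Poly_Mapping.keys m \<subseteq> A then Poly_Mapping.lookup f m else 0)"
    unfolding eval_poly_def
  proof (intro sum.cong refl)
    fix m assume m: "m \<in> Poly_Mapping.keys f"
    have "(\<Prod>i\<in>Poly_Mapping.keys m. char_point n A i ^ Poly_Mapping.lookup m i) =
          (\<Prod>i\<in>Poly_Mapping.keys m. of_bool (i \<in> A))"
    proof (intro prod.cong refl)
      fix i assume i: "i \<in> Poly_Mapping.keys m"
      then have "i \<in> {1..n}" using m f(2) unfolding poly_in_def by blast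
      moreover have "Poly_Mapping.lookup m i \<noteq> 0" using i by (simp add: in_keys_iff)
      ultimately show "char_point n A i ^ Poly_Mapping.lookup m i = of_bool (i \<in> A)"
        by (simp add: char_point_def)
    qed
    also have "\<dots> = of_bool (Poly_Mapping.keys m \<subseteq> A)"
      by (cases "Poly_Mapping.keys m \<subseteq> A") (auto simp: prod_zero_iff intro!: prod.neutral)
    finally show "Poly_Mapping.lookup f m * (\<Prod>i\<in>Poly_Mapping.keys m. char_point n A i ^ Poly_Mapping.lookup m i) =
        (if Poly_Mapping.keys m \<subseteq> A then Poly_Mapping.lookup f m else 0)" by simp
  qed
  also have "\<dots> = (\<Sum>m | m \<in> Poly_Mapping.keys f \<and> Poly_Mapping.keys m \<subseteq> A. Poly_Mapping.lookup f m)"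
    by (subst sum.inter_filter) auto
  also have "\<dots> = (\<Sum>m\<in>sqfree_monom ` Pow A. Poly_Mapping.lookup f m)"
  proof (rule sum.mono_neutral_left)
    show "{m. m \<in> Poly_Mapping.keys f \<and> Poly_Mapping.keys m \<subseteq> A} \<subseteq> sqfree_monom ` Pow A"
      using sqfree_monom_keys[OF f(1)] by (metis (mono_tags, lifting) Pow_iff image_eqI mem_Collect_eq subsetI)
    show "\<forall>m\<in>sqfree_monom ` Pow A - {m. m \<in> Poly_Mapping.keys f \<and> Poly_Mapping.keys m \<subseteq> A}.
            Poly_Mapping.lookup f m = 0"
      using fA by (auto simp: finite_subset in_keys_iff)
  qed (use fA in auto)
  also have "\<dots> = (\<Sum>S\<in>Pow A. Poly_Mapping.lookup f (sqfree_monom S))"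
  proof (subst sum.reindex)
    show "inj_on sqfree_monom (Pow A)"
      using fA by (intro inj_on_inverseI[where g = Poly_Mapping.keys] keys_sqfree_monom) (auto intro: finite_subset)
  qed simp
  finally show ?thesis by (simp add: mlin_def sqfree_coeff_def)
qed

text \<open>
  A squarefree monomial contributes to the coefficient of \<open>\<Prod>i\<in>T. x\<^sub>i\<close> in the partial derivative by \<open>x\<^sub>i\<close>
  exactly when it belongs to \<open>T \<union> {i}\<close> with \<open>i \<notin> T\<close>.
\<close>

lemma harmonic_coeffs_sqfree_coeff:
  assumes f: "multilinear f" "harmonic n f"
  shows "harmonic_coeffs {1..n} (sqfree_coeff f)"
  unfolding harmonic_coeffs_def
proof (intro allI impI)
  fix T :: "nat set" assume T: "T \<subseteq> {1..n}"
  then have fT: "finite T" using finite_subset by auto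
  have coeff: "Poly_Mapping.lookup (partial_deriv i f) (sqfree_monom T) =
               (if i \<in> T then 0 else sqfree_coeff f (insert i T))" for i
  proof -
    have "Poly_Mapping.lookup (partial_deriv i f) (sqfree_monom T) =
          (\<Sum>m\<in>Poly_Mapping.keys f. if m = sqfree_monom (insert i T) \<and> i \<notin> T then Poly_Mapping.lookup f m else 0)"
      unfolding partial_deriv_def lookup_sum
    proof (intro sum.cong refl)
      fix m assume m: "m \<in> Poly_Mapping.keys f"
      define S where "S = Poly_Mapping.keys m"
      have mS: "m = sqfree_monom S" "finite S" using sqfree_monom_keys[OF f(1) m] by (simp_all add: S_def)
      have "m - Poly_Mapping.single i 1 = sqfree_monom (S - {i})"
        using mS by (intro poly_mapping_eqI)
          (auto simp: lookup_minus lookup_sqfree_monom lookup_single when_def)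
      moreover have "sqfree_monom (S - {i}) = sqfree_monom T \<longleftrightarrow> S - {i} = T"
        using mS fT by (metis finite_Diff keys_sqfree_monom)
      moreover have "m = sqfree_monom (insert i T) \<longleftrightarrow> S = insert i T"
        using mS fT by (metis finite_insert keys_sqfree_monom)
      moreover have "Poly_Mapping.lookup m i = of_bool (i \<in> S)" using mS by (simp add: lookup_sqfree_monom)
      ultimately show "Poly_Mapping.lookup (Poly_Mapping.single (m - Poly_Mapping.single i 1)
             (Poly_Mapping.lookup f m * real (Poly_Mapping.lookup m i))) (sqfree_monom T) =
           (if m = sqfree_monom (insert i T) \<and> i \<notin> T then Poly_Mapping.lookup f m else 0)"
        by (auto simp: lookup_single when_def)
    qed
    also have "\<dots> = (if i \<in> T then 0 else sqfree_coeff f (insert i T))"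
      by (auto simp: sqfree_coeff_def in_keys_iff)
    finally show ?thesis .
  qed
  have "0 = Poly_Mapping.lookup (\<Sum>i=1..n. partial_deriv i f) (sqfree_monom T)"
    using f(2) by (simp add: harmonic_def)
  also have "\<dots> = (\<Sum>i=1..n. if i \<in> T then 0 else sqfree_coeff f (insert i T))"
    by (simp only: lookup_sum coeff)
  also have "\<dots> = (\<Sum>i\<in>{1..n} - T. sqfree_coeff f (insert i T))"
    by (rule sum.mono_neutral_cong_right) auto
  finally show "(\<Sum>i\<in>{1..n} - T. sqfree_coeff f (insert i T)) = 0" by simp
qed

text \<open>
  Infinite sets cause no exception, since their cardinality is \<open>0\<close>.
\<close>

lemma sqfree_coeff_degree:
  assumes "sqfree_coeff f S \<noteq> 0"
  shows "card S \<le> total_degree f"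
proof (cases "finite S")
  case True
  have "sqfree_monom S \<in> Poly_Mapping.keys f" using assms by (simp add: sqfree_coeff_def in_keys_iff)
  moreover have "(\<Sum>i\<in>Poly_Mapping.keys (sqfree_monom S). Poly_Mapping.lookup (sqfree_monom S) i) = card S"
    using True by (simp add: lookup_sqfree_monom)
  ultimately have "card S \<in> insert 0 ((\<lambda>m. \<Sum>i\<in>Poly_Mapping.keys m. Poly_Mapping.lookup m i) ` Poly_Mapping.keys f)"
    by (metis (mono_tags, lifting) image_eqI insertCI)
  then show ?thesis unfolding total_degree_def by (intro Max_ge) auto
qed simp

lemma bij_betw_char_point_cube: "bij_betw (char_point n) (Pow {1..n}) (cube n)"
proof (rule bij_betwI[where g = "\<lambda>x. {i \<in> {1..n}. x i = 1}"])
  show "char_point n (Collect (\<lambda>i. i \<in> {1..n} \<and> x i = 1)) = x" if "x \<in> cube n" for x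
  proof
    fix i
    have "i \<in> {1..n} \<Longrightarrow> x i = 0 \<or> x i = 1" using that by (auto simp: cube_def PiE_def Pi_def)
    moreover have "i \<notin> {1..n} \<Longrightarrow> x i = undefined" using that by (auto simp: cube_def PiE_def extensional_def)
    ultimately show "char_point n (Collect (\<lambda>i. i \<in> {1..n} \<and> x i = 1)) i = x i"
      by (auto simp: char_point_def)
  qed
qed (auto simp: char_point_def cube_def)

lemma sum_char_point:
  assumes "A \<subseteq> {1..n}"
  shows "(\<Sum>i=1..n. char_point n A i) = real (card A)"
proof -
  have "(\<Sum>i=1..n. char_point n A i) = (\<Sum>i\<in>A. 1)"
    using assms by (intro sum.mono_neutral_cong_right) (auto simp: char_point_def)
  then show ?thesis by simp
qed

lemma bij_betw_char_point_slice: "bij_betw (char_point n) (level {1..n} k) (slice n k)"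
proof -
  have "slice n k = char_point n ` level {1..n} k"
    using bij_betw_imp_surj_on[OF bij_betw_char_point_cube[of n], symmetric]
    by (auto simp: slice_def level_def sum_char_point simp del: One_nat_def)
  then show ?thesis
    using inj_on_subset[OF bij_betw_imp_inj_on[OF bij_betw_char_point_cube[of n]], of "level {1..n} k"]
    by (auto simp: bij_betw_def level_def)
qed

lemma expectation_nu:
  assumes "k \<le> n"
  shows "measure_pmf.expectation (nu n k) g = level_mean {1..n} k (\<lambda>A. g (char_point n A))"
proof -
  have "measure_pmf.expectation (nu n k) g = sum g (slice n k) / real (card (slice n k))"
    unfolding nu_def by (rule integral_pmf_of_set[OF slice_nonempty[OF assms] finite_slice])
  also have "card (slice n k) = n choose k"
    using bij_betw_same_card[OF bij_betw_char_point_slice[of n k]] by (simp add: card_level)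
  also have "sum g (slice n k) = (\<Sum>A\<in>level {1..n} k. g (char_point n A))"
    by (rule sum.reindex_bij_betw[OF bij_betw_char_point_slice, symmetric])
  finally show ?thesis by (simp add: level_mean_def)
qed

text \<open>
  Under the product measure the size of the set is binomially distributed, and given its size the set is
  uniform.
\<close>

lemma expectation_mu:
  assumes p: "0 < p" "p < 1"
  shows "measure_pmf.expectation (mu n p) g =
         (\<Sum>l\<le>n. Bernstein n l p * level_mean {1..n} l (\<lambda>A. g (char_point n A)))"
proof -
  let ?g = "\<lambda>A. g (char_point n A)"
  have cube: "set_pmf (mu n p) \<subseteq> cube n"
    unfolding mu_def
    by (rule order_trans[OF set_Pi_pmf_subset']) (auto simp: PiE_dflt_def cube_def PiE_def extensional_def)
  have fin: "finite (cube n)" unfolding cube_def by (intro finite_PiE) auto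
  have "measure_pmf.expectation (mu n p) g = (\<Sum>x\<in>cube n. g x * pmf (mu n p) x)"
    by (rule integral_measure_pmf_real[OF fin]) (use cube in auto)
  also have "\<dots> = (\<Sum>A\<in>Pow {1..n}. ?g A * pmf (mu n p) (char_point n A))"
    by (rule sum.reindex_bij_betw[OF bij_betw_char_point_cube, symmetric])
  also have "\<dots> = (\<Sum>A\<in>Pow {1..n}. p ^ card A * (1 - p) ^ (n - card A) * ?g A)"
  proof (intro sum.cong refl)
    fix A assume A: "A \<in> Pow {1..n}"
    then have c: "card A \<le> n" using card_mono[of "{1..n}" A] by simp
    have "char_point n A \<in> cube n" using bij_betwE[OF bij_betw_char_point_cube] A by auto
    then have "pmf (mu n p) (char_point n A) = p powr real (card A) * (1 - p) powr real (n - card A)"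
      using A c p by (simp add: pmf_mu sum_subtractf sum_char_point of_nat_diff del: One_nat_def)
    then show "?g A * pmf (mu n p) (char_point n A) = p ^ card A * (1 - p) ^ (n - card A) * ?g A"
      using p by (simp add: powr_realpow)
  qed
  also have "\<dots> = (\<Sum>l\<le>n. \<Sum>A | A \<in> Pow {1..n} \<and> card A = l. p ^ card A * (1 - p) ^ (n - card A) * ?g A)"
    by (rule sum.group[symmetric]) (use card_mono[of "{1..n}"] in auto)
  also have "\<dots> = (\<Sum>l\<le>n. Bernstein n l p * level_mean {1..n} l ?g)"
  proof (intro sum.cong refl)
    fix l assume "l \<in> {..n}"
    then have "real (n choose l) > 0" by simp
    moreover have "(\<Sum>A | A \<in> Pow {1..n} \<and> card A = l. p ^ card A * (1 - p) ^ (n - card A) * ?g A) =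
          p ^ l * (1 - p) ^ (n - l) * (\<Sum>A\<in>level {1..n} l. ?g A)"
      unfolding sum_distrib_left by (intro sum.cong) (auto simp: level_def)
    ultimately show "(\<Sum>A | A \<in> Pow {1..n} \<and> card A = l. p ^ card A * (1 - p) ^ (n - card A) * ?g A) =
          Bernstein n l p * level_mean {1..n} l ?g"
      by (simp add: Bernstein_def level_mean_def)
  qed
  finally show ?thesis .
qed

lemma level_mean_cong: "(\<And>A. A \<in> level V m \<Longrightarrow> g A = h A) \<Longrightarrow> level_mean V m g = level_mean V m h"
  by (simp add: level_mean_def)

section \<open>The invariance principle\<close>

theorem theorem4p6:
  "\<exists>K>0. \<exists>C>0. \<forall>(n::nat) (p::real) (k::nat) (f::mpoly) (d::nat) (\<phi>::real \<Rightarrow> real).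
     n \<ge> 1 \<longrightarrow> 0 < p \<longrightarrow> p < 1 \<longrightarrow> p * real n = real k \<longrightarrow>
     p * (1 - p) * real n \<ge> 3 * ln (real n) \<longrightarrow>
     poly_in n f \<longrightarrow> multilinear f \<longrightarrow> harmonic n f \<longrightarrow> total_degree f = d \<longrightarrow>
     real d \<le> K * sqrt (p * (1 - p) * real n) \<longrightarrow>
     measure_pmf.variance (nu n k) (eval_poly f) = 1 \<longrightarrow>
     1-lipschitz_on UNIV \<phi> \<longrightarrow>
     \<bar>measure_pmf.expectation (nu n k) (\<lambda>x. \<phi> (eval_poly f x))
        - measure_pmf.expectation (mu n p) (\<lambda>x. \<phi> (eval_poly f x))\<bar>
       \<le> C * sqrt (real d / sqrt (p * (1 - p) * real n))"
proof (rule exI[of _ 1], intro conjI, simp, rule exI[of _ 2], intro conjI, simp, intro allI impI)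
  fix n k d :: nat and p :: real and f :: mpoly and \<phi> :: "real \<Rightarrow> real"
  assume n: "n \<ge> 1" and p: "0 < p" "p < 1" and k: "p * real n = real k"
    and f: "poly_in n f" "multilinear f" "harmonic n f" and deg: "total_degree f = d"
    and d: "real d \<le> 1 * sqrt (p * (1 - p) * real n)"
    and var: "measure_pmf.variance (nu n k) (eval_poly f) = 1"
    and \<phi>: "1-lipschitz_on UNIV \<phi>"
  let ?V = "{1..n}"
  define F where "F = mlin (sqfree_coeff f)"
  have F: "eval_poly f (char_point n A) = F A" if "A \<in> level ?V l" for A l
    using eval_poly_char_point[OF f(2,1), of A] that by (simp add: F_def level_def)
  have "real k \<le> real n" unfolding k[symmetric] using p by (simp add: mult_left_le_one_le)
  then have kn: "k \<le> n" by simp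
  have nu: "measure_pmf.expectation (nu n k) (\<lambda>x. g (eval_poly f x)) = level_mean ?V k (\<lambda>A. g (F A))" for g
    unfolding expectation_nu[OF kn] by (intro level_mean_cong) (simp add: F)
  have mu: "measure_pmf.expectation (mu n p) (\<lambda>x. \<phi> (eval_poly f x)) =
        (\<Sum>l\<le>n. Bernstein n l p * level_mean ?V l (\<lambda>A. \<phi> (F A)))"
    unfolding expectation_mu[OF p]
    by (intro sum.cong refl arg_cong2[where f = "(*)"] level_mean_cong) (simp add: F)
  have int: "integrable (measure_pmf (nu n k)) g" for g :: "(nat \<Rightarrow> real) \<Rightarrow> real"
    using slice_nonempty[OF kn] by (intro integrable_measure_pmf_finite) (simp add: nu_def finite_slice)
  have "measure_pmf.variance (nu n k) (eval_poly f) = measure_pmf.expectation (nu n k) (\<lambda>x. (eval_poly f x)\<^sup>2) -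
      (measure_pmf.expectation (nu n k) (eval_poly f))\<^sup>2"
    by (rule measure_pmf.variance_eq[OF int int])
  then have "level_mean ?V k (\<lambda>A. (F A)\<^sup>2) - (level_mean ?V k F)\<^sup>2 = 1"
    using var nu[of "\<lambda>t. t\<^sup>2"] nu[of "\<lambda>t. t"] by simp
  from level_binomial_invariance[of ?V "sqfree_coeff f" d p k, OF _ harmonic_coeffs_sqfree_coeff[OF f(2,3)] _ p _ refl _ this[unfolded F_def] \<phi>]
  show "\<bar>measure_pmf.expectation (nu n k) (\<lambda>x. \<phi> (eval_poly f x))
        - measure_pmf.expectation (mu n p) (\<lambda>x. \<phi> (eval_poly f x))\<bar>
       \<le> 2 * sqrt (real d / sqrt (p * (1 - p) * real n))"
    using sqfree_coeff_degree[of f] deg k d n by (simp add: nu mu F_def)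
qed

end
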